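(* Let $F=x^3+y^3+z^3$, let $\alpha=\sqrt[3]{3}$ and let $\beta$ be a primitive root of unity of order $9$. There are exactly $72$ type $9$ points on the Fermat cubic $F=0$. Let $I_T\subset\mathbb{Q}(\alpha,\beta)[x,y,z]$ be the homogeneous ideal of the set of these $72$ points, and let $$Q(x,y)=(x^9-3x^6y^3-6x^3y^6-y^9)(x^6+x^3y^3+y^6)(x^9+6x^6y^3+3x^3y^6-y^9),$$ a form of degree $24$, with $Q(x,z)$ and $Q(y,z)$ obtained from it by substitution of variables. Then $$I_T=(F,Q(x,y))=(F,Q(x,z))=(F,Q(y,z)).$$ In particular, the set of type $9$ points on the Fermat cubic is a complete intersection of type $(3,24)$.
   Context: Equip the Fermat cubic $x^3+y^3+z^3=0$ in $\mathbb{P}^2_{\mathbb{C}}$ with its group law having a flex point as origin, so that three points of the cubic sum to zero if and only if they are the intersection (with multiplicity) of the cubic with a line. The flex points are then exactly the points $P$ with $3P=0$. A type $9$ point is a point $P$ of the cubic that is $9$-torsion but not $3$-torsion ($9P=0$, $3P\neq 0$); this does not depend on the choice of flex as origin. All type $9$ points have homogeneous coordinates in $\mathbb{Q}(\alpha,\beta)$, so their homogeneous ideal may be taken in $\mathbb{Q}(\alpha,\beta)[x,y,z]$. *)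

theory Defs
  imports
    "HOL-Library.Poly_Mapping"
    "HOL-Algebra.Ideal"
    "HOL-Algebra.Generated_Fields"
    "HOL-Algebra.Algebraic_Closure_Type"
    "HOL-Analysis.Cartesian_Space"
begin

unbundle no fps_syntax

text \<open>
  A monomial is an exponent vector indexed by the three-element type \<open>3\<close>; the variables
  \<open>x, y, z\<close> have the indices \<open>1, 2, 3\<close> (so \<open>3\<close> is the same index as \<open>0\<close>). The same indices
  are used for the components \<open>v $ 1, v $ 2, v $ 3\<close> of a vector \<open>v\<close>.
\<close>

type_synonym poly3 = "(3 \<Rightarrow>\<^sub>0 nat) \<Rightarrow>\<^sub>0 complex"

definition var3 :: "3 \<Rightarrow> poly3" where
  "var3 i = Poly_Mapping.single (Poly_Mapping.single i 1) 1"

abbreviation "x_var \<equiv> var3 1"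
abbreviation "y_var \<equiv> var3 2"
abbreviation "z_var \<equiv> var3 3"

definition monom_degree :: "(3 \<Rightarrow>\<^sub>0 nat) \<Rightarrow> nat" where
  "monom_degree m = (\<Sum>i\<in>UNIV. Poly_Mapping.lookup m i)"

definition homogeneous :: "nat \<Rightarrow> poly3 \<Rightarrow> bool" where
  "homogeneous d f \<longleftrightarrow> (\<forall>m\<in>Poly_Mapping.keys f. monom_degree m = d)"

text \<open>
  Evaluation along a map \<open>h\<close> of the coefficients. It is used with \<open>h\<close> the identity (values at
  complex vectors) and with \<open>h\<close> the embedding of the constants into \<open>complex poly\<close>
  (restriction to a parametrised line).
\<close>

definition eval3 :: "(complex \<Rightarrow> 'a::comm_ring_1) \<Rightarrow> (3 \<Rightarrow> 'a) \<Rightarrow> poly3 \<Rightarrow> 'a" where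
  "eval3 h u f = (\<Sum>m\<in>Poly_Mapping.keys f.
     h (Poly_Mapping.lookup f m) * (\<Prod>i\<in>UNIV. u i ^ Poly_Mapping.lookup m i))"

definition value3 :: "poly3 \<Rightarrow> complex ^ 3 \<Rightarrow> complex" where
  "value3 f v = eval3 (\<lambda>c. c) (\<lambda>i. v $ i) f"

definition poly_ring3 :: "complex set \<Rightarrow> poly3 ring" where
  "poly_ring3 K = ring_of_type_algebra
     \<lparr>carrier := {f. \<forall>m. Poly_Mapping.lookup f m \<in> K}\<rparr>"

text \<open>A point is the set of all its homogeneous coordinate vectors.\<close>

type_synonym point = "(complex ^ 3) set"

definition proj :: "complex ^ 3 \<Rightarrow> point" where
  "proj v = {c *s v | c. c \<noteq> 0}"

definition proj_plane :: "point set" where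
  "proj_plane = proj ` {v. v \<noteq> 0}"

definition vanishes_at :: "poly3 \<Rightarrow> point \<Rightarrow> bool" where
  "vanishes_at f P \<longleftrightarrow> (\<forall>v\<in>P. value3 f v = 0)"

text \<open>
  The homogeneous ideal in \<open>K[x,y,z]\<close> of a set of points: the ideal generated by all forms
  over \<open>K\<close> that vanish on the set.
\<close>

definition vanishing_ideal :: "complex set \<Rightarrow> point set \<Rightarrow> poly3 set" where
  "vanishing_ideal K S = Idl\<^bsub>poly_ring3 K\<^esub>
     {f \<in> carrier (poly_ring3 K). (\<exists>d. homogeneous d f) \<and> (\<forall>P\<in>S. vanishes_at f P)}"

text \<open>
  A set of points in the plane is a complete intersection of type \<open>(a, b)\<close> (over \<open>K\<close>) if its
  homogeneous ideal is generated by a regular sequence of two forms of degrees \<open>a\<close> and \<open>b\<close>.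
\<close>

definition regular_sequence :: "('a, 'm) ring_scheme \<Rightarrow> 'a \<Rightarrow> 'a \<Rightarrow> bool" where
  "regular_sequence R f g \<longleftrightarrow>
     (\<forall>h\<in>carrier R. f \<otimes>\<^bsub>R\<^esub> h = \<zero>\<^bsub>R\<^esub> \<longrightarrow> h = \<zero>\<^bsub>R\<^esub>) \<and>
     (\<forall>h\<in>carrier R. g \<otimes>\<^bsub>R\<^esub> h \<in> Idl\<^bsub>R\<^esub> {f} \<longrightarrow> h \<in> Idl\<^bsub>R\<^esub> {f}) \<and>
     Idl\<^bsub>R\<^esub> {f, g} \<noteq> carrier R"

definition complete_intersection :: "complex set \<Rightarrow> point set \<Rightarrow> nat \<Rightarrow> nat \<Rightarrow> bool" where
  "complete_intersection K S a b \<longleftrightarrow>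
     (\<exists>f\<in>carrier (poly_ring3 K). \<exists>g\<in>carrier (poly_ring3 K).
        homogeneous a f \<and> homogeneous b g \<and>
        regular_sequence (poly_ring3 K) f g \<and>
        vanishing_ideal K S = Idl\<^bsub>poly_ring3 K\<^esub> {f, g})"

definition fermat_form :: poly3 where
  "fermat_form = x_var ^ 3 + y_var ^ 3 + z_var ^ 3"

definition fermat_cubic :: "point set" where
  "fermat_cubic = {P \<in> proj_plane. vanishes_at fermat_form P}"

definition on_line :: "complex ^ 3 \<Rightarrow> complex ^ 3 \<Rightarrow> bool" where
  "on_line a v \<longleftrightarrow> (\<Sum>i\<in>UNIV. a $ i * v $ i) = 0"

text \<open>
  The polynomial \<open>F(v + t w)\<close> in \<open>t\<close>. If \<open>v\<close> and \<open>w\<close> represent two different points, the order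
  of its zero at \<open>t = 0\<close> is the intersection multiplicity at the point \<open>v\<close> of the cubic with
  the line through \<open>v\<close> and \<open>w\<close>; it does not depend on the choice of \<open>w\<close> on this line.
\<close>

definition fermat_on_line :: "complex ^ 3 \<Rightarrow> complex ^ 3 \<Rightarrow> complex poly" where
  "fermat_on_line v w = eval3 (\<lambda>c. [:c:]) (\<lambda>i. [:v $ i, w $ i:]) fermat_form"

definition line_section :: "complex ^ 3 \<Rightarrow> point multiset \<Rightarrow> bool" where
  "line_section a M \<longleftrightarrow>
     (\<forall>P\<in>#M. P \<in> proj_plane \<and> (\<forall>v\<in>P. on_line a v)) \<and>
     (\<forall>v w. v \<noteq> 0 \<and> w \<noteq> 0 \<and> proj v \<noteq> proj w \<and> on_line a v \<and> on_line a w \<longrightarrow>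
        count M (proj v) = Polynomial.order 0 (fermat_on_line v w))"

definition cut_by_line :: "point multiset \<Rightarrow> bool" where
  "cut_by_line M \<longleftrightarrow> (\<exists>a. a \<noteq> 0 \<and> line_section a M)"

definition flex :: "point \<Rightarrow> bool" where
  "flex P \<longleftrightarrow> P \<in> fermat_cubic \<and> cut_by_line {#P, P, P#}"

text \<open>
  The chord-tangent construction: the line through \<open>P\<close> and \<open>Q\<close> (the tangent at \<open>P\<close> if
  \<open>P = Q\<close>) meets the cubic in a unique third point, and the sum of \<open>P\<close> and \<open>Q\<close> is the third
  point on the line through the origin \<open>e\<close> and that point. When \<open>e\<close> is a flex, three points
  have sum \<open>e\<close> iff they are cut out by a line. The group is written multiplicatively, as
  everywhere in HOL-Algebra: \<open>n P\<close> is \<open>P [^] n\<close>.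
\<close>

definition third_point :: "point \<Rightarrow> point \<Rightarrow> point" where
  "third_point P Q = (THE R. cut_by_line {#P, Q, R#})"

definition fermat_group :: "point \<Rightarrow> point monoid" where
  "fermat_group e = \<lparr>carrier = fermat_cubic,
     monoid.mult = (\<lambda>P Q. third_point e (third_point P Q)),
     one = e\<rparr>"

definition type9_points :: "point \<Rightarrow> point set" where
  "type9_points e = {P \<in> carrier (fermat_group e).
     P [^]\<^bsub>fermat_group e\<^esub> (9::nat) = \<one>\<^bsub>fermat_group e\<^esub> \<and>
     P [^]\<^bsub>fermat_group e\<^esub> (3::nat) \<noteq> \<one>\<^bsub>fermat_group e\<^esub>}"

definition adjoin :: "complex set \<Rightarrow> complex set" where
  "adjoin A = generate_field ring_of_type_algebra A"

definition primitive_root_of_unity :: "nat \<Rightarrow> complex \<Rightarrow> bool" where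
  "primitive_root_of_unity n b \<longleftrightarrow> b ^ n = 1 \<and> (\<forall>k. 0 < k \<and> k < n \<longrightarrow> b ^ k \<noteq> 1)"

definition Q_form :: "poly3 \<Rightarrow> poly3 \<Rightarrow> poly3" where
  "Q_form p q =
     (p ^ 9 - 3 * p ^ 6 * q ^ 3 - 6 * p ^ 3 * q ^ 6 - q ^ 9) *
     (p ^ 6 + p ^ 3 * q ^ 3 + q ^ 6) *
     (p ^ 9 + 6 * p ^ 6 * q ^ 3 + 3 * p ^ 3 * q ^ 6 - q ^ 9)"

end

theory Submission
  imports Defs "HOL-Computational_Algebra.Fundamental_Theorem_Algebra"
begin

unbundle no Formal_Power_Series.fps_syntax

text \<open>
  Take the flex \<open>(1 : -1 : 0)\<close> as origin; then \<open>- (x : y : z) = (y : x : z)\<close>. The tangent at a point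
  \<open>P = (x : y : z)\<close> meets the cubic again at
  \<open>- 2 P = (x (y\<^sup>3 - z\<^sup>3) : y (z\<^sup>3 - x\<^sup>3) : z (x\<^sup>3 - y\<^sup>3))\<close>, so \<open>3 P = 0\<close> if and only if \<open>x y z = 0\<close>
  (\<open>cube_eq_one_iff\<close>). The line through \<open>P\<close> and \<open>2 P\<close> gives
  \<open>- 3 P = (Q\<^sub>1 : - Q\<^sub>3 : - 3 x y z Q\<^sub>2)\<close>, where \<open>Q\<^sub>1, Q\<^sub>2, Q\<^sub>3\<close> are the three factors of \<open>Q(x, y)\<close>
  (\<open>third_point_double\<close>). As \<open>9 P = 3 (3 P)\<close>, the point \<open>P\<close> is \<open>9\<close>-torsion if and only if
  \<open>x y z Q(x, y) = 0\<close>, and since \<open>Q(x, y)\<close> has no zero in common with \<open>x y z\<close> on the cubic, the type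
  \<open>9\<close> points are exactly the zeros of \<open>Q(x, y)\<close> on it (\<open>type9_points_eq\<close>). Another flex \<open>e\<close> as origin
  replaces the sum by \<open>P + Q - e\<close> with \<open>3 e = 0\<close>, which changes neither \<open>3 P = 0\<close> nor \<open>9 P = 0\<close>.

  The step \<open>9 P = 3 (3 P)\<close> needs the associativity of the chord-tangent law. For points in general
  position it is a polynomial identity for the addition formula of Hesse (\<open>hesse_assoc\<close>). The
  formula fails for certain pairs, but the cyclic permutation of the coordinates is a translation by
  a point of order three, and by such translations every triple can be brought into a position where
  all four sums are given by the formula (\<open>chord_sum_assoc\<close>).

  For the ideal, \<open>Q(t, 1)\<close> has 24 different roots \<open>t\<close>, and over each of them the cubic has three
  different points \<open>(t : 1 : z)\<close>; this gives 72 points. A form that vanishes there is divided with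
  remainder by \<open>F\<close>, monic in \<open>z\<close>, and then by \<open>Q(x, y)\<close>, monic in \<open>x\<close>. The remainder has degree less
  than 3 in \<open>z\<close> and less than 24 in \<open>x\<close>, and has too many zeros not to be zero
  (\<open>reduced_vanishing\<close>). Hence \<open>F\<close> and \<open>Q(x, y)\<close> generate the ideal, over every subring of the
  complex numbers; the other two generators differ from \<open>Q(x, y)\<close> by multiples of \<open>F\<close>
  (\<open>Q_value_diff\<close>). The same counting of zeros shows that \<open>F, Q(x, y)\<close> is a regular sequence.
\<close>

section \<open>Evaluation of ternary polynomials\<close>

lemma poly_mapping_eq_sum_singles:
  "f = (\<Sum>m\<in>Poly_Mapping.keys f. Poly_Mapping.single m (Poly_Mapping.lookup f m))"
  by (rule poly_mapping_eqI) (simp add: lookup_sum lookup_single when_def in_keys_iff)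

text \<open>Both uses of \<open>eval3\<close>, at complex vectors and along a line, are substitutions into a commutative
  ring that extend a homomorphism of the coefficients.\<close>

locale coeff_hom =
  fixes h :: "complex \<Rightarrow> 'a::comm_ring_1"
  assumes hom_add: "h (a + b) = h a + h b"
    and hom_mult: "h (a * b) = h a * h b"
    and hom_one: "h 1 = 1"
begin

lemma hom_zero: "h 0 = 0"
  using hom_add[of 0 0] by simp

lemma eval3_superset:
  assumes "finite A" "Poly_Mapping.keys f \<subseteq> A"
  shows "eval3 h u f =
    (\<Sum>m\<in>A. h (Poly_Mapping.lookup f m) * (\<Prod>i\<in>UNIV. u i ^ Poly_Mapping.lookup m i))"
  unfolding eval3_def
  by (rule sum.mono_neutral_left)
     (use assms in \<open>auto simp: hom_zero in_keys_iff\<close>)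

lemma eval3_zero [simp]: "eval3 h u 0 = 0"
  by (simp add: eval3_def)

lemma eval3_single:
  "eval3 h u (Poly_Mapping.single m c) = h c * (\<Prod>i\<in>UNIV. u i ^ Poly_Mapping.lookup m i)"
  by (subst eval3_superset[of "{m}"]) auto

lemma eval3_add: "eval3 h u (f + g) = eval3 h u f + eval3 h u g"
proof -
  let ?A = "Poly_Mapping.keys f \<union> Poly_Mapping.keys g"
  have "finite ?A" "Poly_Mapping.keys (f + g) \<subseteq> ?A"
    by (auto simp: Poly_Mapping.keys_add)
  then show ?thesis
    by (simp add: eval3_superset[of ?A] lookup_add hom_add distrib_right sum.distrib)
qed

lemma eval3_sum: "eval3 h u (sum F A) = (\<Sum>a\<in>A. eval3 h u (F a))"
  by (induction A rule: infinite_finite_induct) (auto simp: eval3_add)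

lemma eval3_mult: "eval3 h u (f * g) = eval3 h u f * eval3 h u g"
proof -
  let ?f = "Poly_Mapping.lookup f" and ?g = "Poly_Mapping.lookup g"
  have "f * g = (\<Sum>m\<in>Poly_Mapping.keys f. Poly_Mapping.single m (?f m)) *
      (\<Sum>n\<in>Poly_Mapping.keys g. Poly_Mapping.single n (?g n))"
    by (rule arg_cong2[OF poly_mapping_eq_sum_singles poly_mapping_eq_sum_singles])
  also have "\<dots> = (\<Sum>m\<in>Poly_Mapping.keys f. \<Sum>n\<in>Poly_Mapping.keys g.
      Poly_Mapping.single (m + n) (?f m * ?g n))"
    by (simp add: sum_product Poly_Mapping.mult_single)
  finally have "eval3 h u (f * g) = (\<Sum>m\<in>Poly_Mapping.keys f. \<Sum>n\<in>Poly_Mapping.keys g.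
      h (?f m * ?g n) * (\<Prod>i\<in>UNIV. u i ^ Poly_Mapping.lookup (m + n) i))"
    by (simp add: eval3_sum eval3_single)
  also have "\<dots> = eval3 h u f * eval3 h u g"
    by (simp add: eval3_def sum_product lookup_add power_add prod.distrib hom_mult ac_simps)
  finally show ?thesis .
qed

lemma eval3_one [simp]: "eval3 h u 1 = 1"
  using eval3_single[of u 0 1] by (simp add: hom_one)

lemma eval3_power: "eval3 h u (f ^ n) = eval3 h u f ^ n"
  by (induction n) (auto simp: eval3_mult)

lemma eval3_of_nat: "eval3 h u (of_nat n) = of_nat n"
  by (induction n) (auto simp: eval3_add)

lemma eval3_numeral [simp]: "eval3 h u (numeral n) = numeral n"
  using eval3_of_nat[of u "numeral n"] by simp

lemma eval3_minus: "eval3 h u (f - g) = eval3 h u f - eval3 h u g"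
  using eval3_add[of u "f - g" g] by simp

lemma eval3_var [simp]: "eval3 h u (var3 i) = u i"
proof -
  have "u j ^ Poly_Mapping.lookup (Poly_Mapping.single i 1) j = (if j = i then u i else 1)" for j
    by (simp add: lookup_single when_def)
  then show ?thesis
    by (simp add: var3_def eval3_single hom_one)
qed

lemmas eval3_hom = eval3_add eval3_minus eval3_mult eval3_power

lemma eval3_fermat: "eval3 h u fermat_form = u 1 ^ 3 + u 2 ^ 3 + u 3 ^ 3"
  by (simp add: fermat_form_def eval3_hom)

end

interpretation coeff_id: coeff_hom "\<lambda>c. c :: complex"
  by standard auto

interpretation coeff_const: coeff_hom "\<lambda>c. [:c:] :: complex poly"
  by standard (auto simp: one_pCons)


section \<open>Coordinates and lines\<close>

abbreviation vec3 :: "complex \<Rightarrow> complex \<Rightarrow> complex \<Rightarrow> complex ^ 3" where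
  "vec3 a b c \<equiv> vector [a, b, c]"

definition cubic :: "complex ^ 3 \<Rightarrow> complex" where
  "cubic v = v $ 1 ^ 3 + v $ 2 ^ 3 + v $ 3 ^ 3"

definition cross :: "complex ^ 3 \<Rightarrow> complex ^ 3 \<Rightarrow> complex ^ 3" where
  "cross v w = vec3 (v $ 2 * w $ 3 - v $ 3 * w $ 2) (v $ 3 * w $ 1 - v $ 1 * w $ 3)
     (v $ 1 * w $ 2 - v $ 2 * w $ 1)"

lemma vec3_eq_iff: "v = w \<longleftrightarrow> v $ 1 = w $ 1 \<and> v $ 2 = w $ 2 \<and> v $ 3 = (w $ 3 :: complex)"
  for v w :: "complex ^ 3"
  by (simp add: vec_eq_iff forall_3)

lemma cross_components:
  "cross v w $ 1 = v $ 2 * w $ 3 - v $ 3 * w $ 2"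
  "cross v w $ 2 = v $ 3 * w $ 1 - v $ 1 * w $ 3"
  "cross v w $ 3 = v $ 1 * w $ 2 - v $ 2 * w $ 1"
  by (simp_all add: cross_def)

lemma on_line_iff: "on_line a v \<longleftrightarrow> a $ 1 * v $ 1 + a $ 2 * v $ 2 + a $ 3 * v $ 3 = 0"
  by (simp add: on_line_def sum_3)

lemma value3_fermat: "value3 fermat_form v = cubic v"
  by (simp add: value3_def coeff_id.eval3_fermat cubic_def)

lemma cubic_scale: "cubic (c *s v) = c ^ 3 * cubic v"
  by (simp add: cubic_def algebra_simps)

lemma poly_fermat_on_line: "poly (fermat_on_line v w) t = cubic (v + t *s w)"
  by (simp add: fermat_on_line_def coeff_const.eval3_fermat cubic_def)

lemma self_in_proj: "v \<in> proj v"
  unfolding proj_def by (auto intro!: exI[of _ 1])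

lemma proj_scale: "c \<noteq> 0 \<Longrightarrow> proj (c *s v) = proj v"
proof -
  assume c: "c \<noteq> 0"
  have "\<exists>d'. d *s v = d' *s (c *s v) \<and> d' \<noteq> 0" if "d \<noteq> 0" for d
    by (rule exI[of _ "d / c"]) (use that c in auto)
  then show ?thesis
    unfolding proj_def using c by (auto simp: vector_smult_assoc)
qed

lemma parallel_imp_scale:
  assumes "v \<noteq> 0" "cross v w = 0"
  shows "\<exists>c. w = c *s v"
proof -
  have c: "v $ 2 * w $ 3 = v $ 3 * w $ 2" "v $ 3 * w $ 1 = v $ 1 * w $ 3"
      "v $ 1 * w $ 2 = v $ 2 * w $ 1"
    using assms(2) by (simp_all add: vec3_eq_iff cross_components)
  from assms(1) consider "v $ 1 \<noteq> 0" | "v $ 2 \<noteq> 0" | "v $ 3 \<noteq> 0"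
    by (auto simp: vec3_eq_iff)
  then show ?thesis
  proof cases
    case 1
    then show ?thesis using c
      by (intro exI[of _ "w $ 1 / v $ 1"]) (auto simp: vec3_eq_iff field_simps)
  next
    case 2
    then show ?thesis using c
      by (intro exI[of _ "w $ 2 / v $ 2"]) (auto simp: vec3_eq_iff field_simps)
  next
    case 3
    then show ?thesis using c
      by (intro exI[of _ "w $ 3 / v $ 3"]) (auto simp: vec3_eq_iff field_simps)
  qed
qed

lemma cross_scale_self: "cross v (c *s v) = 0"
  by (simp add: vec3_eq_iff cross_components)

lemma proj_eq_iff:
  assumes "v \<noteq> 0" "w \<noteq> 0"
  shows "proj v = proj w \<longleftrightarrow> cross v w = 0"
proof
  assume "proj v = proj w"
  then have "w \<in> proj v" using self_in_proj by blast
  then show "cross v w = 0" by (auto simp: proj_def cross_scale_self)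
next
  assume "cross v w = 0"
  then obtain c where "w = c *s v" using parallel_imp_scale assms(1) by blast
  moreover have "c \<noteq> 0" using assms(2) calculation by auto
  ultimately show "proj v = proj w" by (simp add: proj_scale)
qed

lemma on_line_scale: "c \<noteq> 0 \<Longrightarrow> on_line a (c *s v) \<longleftrightarrow> on_line a v"
proof -
  assume "c \<noteq> 0"
  moreover have "a $ 1 * (c * v $ 1) + a $ 2 * (c * v $ 2) + a $ 3 * (c * v $ 3) =
    c * (a $ 1 * v $ 1 + a $ 2 * v $ 2 + a $ 3 * v $ 3)"
    by (simp add: algebra_simps)
  ultimately show ?thesis by (simp add: on_line_iff)
qed

lemma on_line_proj: "(\<forall>v\<in>proj v0. on_line a v) \<longleftrightarrow> on_line a v0"
  using self_in_proj by (auto simp: proj_def on_line_scale)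

lemma on_line_parallel:
  assumes "a \<noteq> 0" "a' \<noteq> 0" "cross a a' = 0"
  shows "on_line a v \<longleftrightarrow> on_line a' v"
proof -
  obtain c where c: "a' = c *s a" using parallel_imp_scale assms by blast
  then have "c \<noteq> 0" using assms(2) by auto
  moreover have "c * a $ 1 * v $ 1 + c * a $ 2 * v $ 2 + c * a $ 3 * v $ 3 =
    c * (a $ 1 * v $ 1 + a $ 2 * v $ 2 + a $ 3 * v $ 3)"
    by (simp add: algebra_simps)
  ultimately show ?thesis using c by (simp add: on_line_iff)
qed

text \<open>This identity carries all the linear algebra below: two vectors that are orthogonal to a vector
  \<open>a\<close> have a cross product parallel to \<open>a\<close>.\<close>

lemma cross_cross:
  "cross a (cross v w) = (a $ 1 * w $ 1 + a $ 2 * w $ 2 + a $ 3 * w $ 3) *s v -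
     (a $ 1 * v $ 1 + a $ 2 * v $ 2 + a $ 3 * v $ 3) *s w"
  by (simp add: vec3_eq_iff cross_components algebra_simps)

lemma line_through:
  assumes "on_line a v" "on_line a w"
  shows "cross a (cross v w) = 0"
  using assms by (simp add: cross_cross on_line_iff)

lemma in_span_if_on_line:
  assumes "cross p q \<noteq> 0" "on_line (cross p q) v"
  shows "\<exists>s t. v = s *s p + t *s q"
proof -
  have det: "(p $ 2 * q $ 3 - p $ 3 * q $ 2) * v $ 1 + (p $ 3 * q $ 1 - p $ 1 * q $ 3) * v $ 2 +
    (p $ 1 * q $ 2 - p $ 2 * q $ 1) * v $ 3 = 0"
    using assms(2) by (simp add: on_line_iff cross_components)
  have solve: "\<exists>s t. v = s *s p + t *s q"
    if "c \<noteq> 0" "c * v $ 1 - (s * p $ 1 + t * q $ 1) = 0" "c * v $ 2 - (s * p $ 2 + t * q $ 2) = 0"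
      "c * v $ 3 - (s * p $ 3 + t * q $ 3) = 0" for c s t
    by (rule exI[of _ "s / c"], rule exI[of _ "t / c"])
      (use that in \<open>simp add: vec3_eq_iff field_simps\<close>)
  from assms(1) consider "p $ 2 * q $ 3 - p $ 3 * q $ 2 \<noteq> 0" | "p $ 3 * q $ 1 - p $ 1 * q $ 3 \<noteq> 0"
    | "p $ 1 * q $ 2 - p $ 2 * q $ 1 \<noteq> 0"
    by (auto simp: vec3_eq_iff cross_components)
  then show ?thesis
  proof cases
    case 1
    show ?thesis
      by (rule solve[OF 1, where s = "v $ 2 * q $ 3 - v $ 3 * q $ 2" and t = "p $ 2 * v $ 3 - p $ 3 * v $ 2"])
        (use det in \<open>simp add: algebra_simps\<close>)+
  next
    case 2
    show ?thesis
      by (rule solve[OF 2, where s = "v $ 3 * q $ 1 - v $ 1 * q $ 3" and t = "p $ 3 * v $ 1 - p $ 1 * v $ 3"])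
        (use det in \<open>simp add: algebra_simps\<close>)+
  next
    case 3
    show ?thesis
      by (rule solve[OF 3, where s = "v $ 1 * q $ 2 - v $ 2 * q $ 1" and t = "p $ 1 * v $ 2 - p $ 2 * v $ 1"])
        (use det in \<open>simp add: algebra_simps\<close>)+
  qed
qed

text \<open>A complex vector can be isotropic, and then \<open>cross a v\<close> is a multiple of \<open>v\<close>. The complex conjugate of
  \<open>v\<close> in place of \<open>v\<close> avoids this.\<close>

lemma second_point_on_line:
  assumes "a \<noteq> 0" "v \<noteq> 0" "on_line a v"
  shows "\<exists>c. cross a c \<noteq> 0 \<and> on_line a (cross a c) \<and> cross v (cross a c) \<noteq> 0"
proof -
  define c where "c = vec3 (cnj (v $ 1)) (cnj (v $ 2)) (cnj (v $ 3))"
  define w where "w = cross a c"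
  have sq: "v $ 1 * cnj (v $ 1) + v $ 2 * cnj (v $ 2) + v $ 3 * cnj (v $ 3) \<noteq> 0"
  proof
    assume "v $ 1 * cnj (v $ 1) + v $ 2 * cnj (v $ 2) + v $ 3 * cnj (v $ 3) = 0"
    then have "complex_of_real ((norm (v $ 1))\<^sup>2 + (norm (v $ 2))\<^sup>2 + (norm (v $ 3))\<^sup>2) = 0"
      by (simp add: complex_norm_square del: of_real_power)
    then have "(norm (v $ 1))\<^sup>2 + (norm (v $ 2))\<^sup>2 + (norm (v $ 3))\<^sup>2 = 0"
      using of_real_eq_0_iff by blast
    then have "(norm (v $ 1))\<^sup>2 = 0" "(norm (v $ 2))\<^sup>2 = 0" "(norm (v $ 3))\<^sup>2 = 0"
      by (smt (verit) zero_le_power2)+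
    then have "v $ 1 = 0" "v $ 2 = 0" "v $ 3 = 0"
      by simp_all
    then show False using assms(2) by (simp add: vec3_eq_iff)
  qed
  have "on_line a v" by fact
  then have av: "a $ 1 * v $ 1 + a $ 2 * v $ 2 + a $ 3 * v $ 3 = 0"
    by (simp add: on_line_iff)
  \<comment> \<open>\<open>v \<times> (a \<times> c) = a (v \<cdot> c) - c (v \<cdot> a)\<close>, and \<open>v \<cdot> c\<close> is the squared norm of \<open>v\<close>.\<close>
  let ?n = "v $ 1 * c $ 1 + v $ 2 * c $ 2 + v $ 3 * c $ 3"
  have "cross v w = ?n *s a"
    using av by (simp add: w_def cross_cross mult.commute)
  moreover have "?n \<noteq> 0"
    using sq by (simp add: c_def)
  ultimately have *: "cross v w \<noteq> 0"
    using assms(1) by simp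
  moreover have "w \<noteq> 0" using * by (auto simp: vec3_eq_iff cross_components)
  moreover have "on_line a w"
    by (simp add: w_def on_line_iff cross_components algebra_simps)
  ultimately show ?thesis unfolding w_def by blast
qed


section \<open>Intersections of the cubic with lines\<close>

lemma cross_eq_0_commute: "cross v w = 0 \<longleftrightarrow> cross w v = 0"
proof -
  have "cross v w = - cross w v"
    by (simp add: vec3_eq_iff cross_components)
  then show ?thesis by simp
qed

lemma line_section_count:
  assumes "line_section a M" "v \<noteq> 0" "w \<noteq> 0" "on_line a v" "on_line a w" "proj v \<noteq> proj w"
  shows "count M (proj v) = Polynomial.order 0 (fermat_on_line v w)"
  using assms unfolding line_section_def by blast

lemma line_section_on_line:
  assumes "line_section a M" "proj v \<in># M"
  shows "on_line a v"
  using assms self_in_proj unfolding line_section_def by blast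

text \<open>Every point of the line is the point \<open>v\<close> of some pair \<open>v, w\<close> to which the multiplicity condition
  applies, so all multiplicities are prescribed.\<close>

lemma line_section_unique:
  assumes "a \<noteq> 0" "line_section a M" "line_section a M'"
  shows "M = M'"
proof -
  have sub: "N \<subseteq># N'" if N: "line_section a N" "line_section a N'" for N N'
  proof (rule mset_subset_eqI)
    fix Z
    show "count N Z \<le> count N' Z"
    proof (cases "Z \<in># N")
      case True
      then have "Z \<in> proj_plane" "\<forall>v\<in>Z. on_line a v"
        using N(1) by (auto simp: line_section_def)
      then obtain v where v: "v \<noteq> 0" "Z = proj v" "on_line a v"
        by (auto simp: proj_plane_def on_line_proj)
      obtain w where w: "w \<noteq> 0" "on_line a w" "cross v w \<noteq> 0"
        using second_point_on_line[OF assms(1) v(1,3)] by blast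
      then have "proj v \<noteq> proj w" using v by (simp add: proj_eq_iff)
      then have "count N (proj v) = Polynomial.order 0 (fermat_on_line v w)"
        "count N' (proj v) = Polynomial.order 0 (fermat_on_line v w)"
        using line_section_count[OF N(1)] line_section_count[OF N(2)] v w by blast+
      then show ?thesis using v by simp
    qed (simp add: not_in_iff)
  qed
  show ?thesis
    using sub[OF assms(2,3)] sub[OF assms(3,2)] by (rule subset_mset.antisym)
qed

lemma line_section_parallel:
  assumes "a \<noteq> 0" "a' \<noteq> 0" "cross a a' = 0" "line_section a M"
  shows "line_section a' M"
proof -
  have "on_line a v \<longleftrightarrow> on_line a' v" for v
    using on_line_parallel[OF assms(1-3)] .
  then show ?thesis using assms(4) by (simp add: line_section_def)
qed

text \<open>A third of the derivative of \<open>F\<close> at \<open>p\<close> in the direction \<open>q\<close>, and so, up to the factor 3, a middle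
  coefficient of \<open>F\<close> restricted to the line through \<open>p\<close> and \<open>q\<close>.\<close>

definition polar :: "complex ^ 3 \<Rightarrow> complex ^ 3 \<Rightarrow> complex" where
  "polar p q = p $ 1 ^ 2 * q $ 1 + p $ 2 ^ 2 * q $ 2 + p $ 3 ^ 2 * q $ 3"

lemma cubic_combination:
  "cubic (s *s p + t *s q) = s ^ 3 * cubic p + 3 * s ^ 2 * t * polar p q +
     3 * s * t ^ 2 * polar q p + t ^ 3 * cubic q"
  by (simp add: cubic_def polar_def power2_eq_square power3_eq_cube algebra_simps)

definition grad :: "complex ^ 3 \<Rightarrow> complex ^ 3" where
  "grad p = vec3 (p $ 1 ^ 2) (p $ 2 ^ 2) (p $ 3 ^ 2)"

text \<open>The four hypotheses say that \<open>F\<close> vanishes on the whole line through \<open>p\<close> and \<open>q\<close>. On such a line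
  the squares and products of coordinates would all be multiples of one vector, which makes the
  square of every minor of \<open>p, q\<close> vanish.\<close>

lemma not_contains_line:
  assumes "cubic p = 0" "cubic q = 0" "polar p q = 0" "polar q p = 0"
  shows "cross p q = 0"
proof (rule ccontr)
  assume nz: "cross p q \<noteq> 0"
  \<comment> \<open>The vectors of the \<open>p\<^sub>i\<^sup>2\<close>, the \<open>p\<^sub>i q\<^sub>i\<close> and the \<open>q\<^sub>i\<^sup>2\<close> are all orthogonal to \<open>p\<close> and \<open>q\<close>.\<close>
  let ?a = "cross p q"
  define pq where "pq = vec3 (p $ 1 * q $ 1) (p $ 2 * q $ 2) (p $ 3 * q $ 3)"
  have "on_line (grad p) p" "on_line (grad p) q" "on_line pq p" "on_line pq q"
      "on_line (grad q) p" "on_line (grad q) q"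
    using assms by (simp_all add: on_line_iff grad_def pq_def cubic_def polar_def
        power2_eq_square power3_eq_cube mult_ac)
  then have "cross (grad p) ?a = 0" "cross pq ?a = 0" "cross (grad q) ?a = 0"
    using line_through by blast+
  then have "cross ?a (grad p) = 0" "cross ?a pq = 0" "cross ?a (grad q) = 0"
    by (simp_all add: cross_eq_0_commute)
  then obtain c d e where cde: "grad p = c *s ?a" "pq = d *s ?a" "grad q = e *s ?a"
    using parallel_imp_scale nz by metis
  have p: "p $ i ^ 2 = c * ?a $ i" and m: "p $ i * q $ i = d * ?a $ i"
    and q: "q $ i ^ 2 = e * ?a $ i" for i
    using cde exhaust_3[of i] by (auto simp: vec3_eq_iff grad_def pq_def)
  have disc: "(c * e - d ^ 2) * ?a $ i ^ 2 = 0" for i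
  proof -
    have "(p $ i * q $ i) ^ 2 = p $ i ^ 2 * q $ i ^ 2" by (simp add: power_mult_distrib)
    then show ?thesis unfolding p q m by (auto simp: algebra_simps power2_eq_square)
  qed
  have sq: "(p $ i * q $ j - p $ j * q $ i) ^ 2 = 0" for i j
  proof -
    have "(p $ i * q $ j - p $ j * q $ i) ^ 2 =
        p $ i ^ 2 * q $ j ^ 2 - 2 * (p $ i * q $ i) * (p $ j * q $ j) + p $ j ^ 2 * q $ i ^ 2"
      by (simp add: power2_eq_square algebra_simps)
    also have "\<dots> = 2 * (c * e - d ^ 2) * ?a $ i * ?a $ j"
      unfolding p q m by (simp add: power2_eq_square algebra_simps)
    also have "\<dots> = 0" using disc[of i] by auto
    finally show ?thesis .
  qed
  then have "p $ i * q $ j - p $ j * q $ i = 0" for i j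
    using zero_eq_power2 by blast
  then show False using nz by (simp add: vec3_eq_iff cross_components)
qed

lemma grad_nonzero: "p \<noteq> 0 \<Longrightarrow> grad p \<noteq> 0"
  by (auto simp: grad_def vec3_eq_iff)

lemma on_line_grad: "on_line (grad p) q \<longleftrightarrow> polar p q = 0"
  by (simp add: on_line_iff grad_def polar_def)

lemma polar_self: "polar p p = cubic p"
  by (simp add: polar_def cubic_def power2_eq_square power3_eq_cube)

lemma fermat_on_line_coeffs:
  "fermat_on_line v w = [:cubic v, 3 * polar v w, 3 * polar w v, cubic w:]"
proof -
  have "poly (fermat_on_line v w) t = poly [:cubic v, 3 * polar v w, 3 * polar w v, cubic w:] t"
    for t
    using cubic_combination[of 1 v t w]
    by (simp add: poly_fermat_on_line power2_eq_square power3_eq_cube algebra_simps)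
  then show ?thesis using poly_eq_poly_eq_iff by blast
qed

text \<open>If the two points coincide, the count forces a double zero of \<open>F\<close> along the line, so that the
  polar vanishes and the line is the tangent.\<close>

lemma line_of_section:
  assumes "a \<noteq> 0" "line_section a {#proj p, proj q, R#}" "p \<noteq> 0" "q \<noteq> 0"
  shows "cross a (if proj p = proj q then grad p else cross p q) = 0"
proof (cases "proj p = proj q")
  case True
  have p: "on_line a p"
    using line_section_on_line[OF assms(2)] by auto
  obtain w where w: "w \<noteq> 0" "on_line a w" "cross p w \<noteq> 0"
    using second_point_on_line[OF assms(1,3) p] by blast
  then have "proj p \<noteq> proj w" using assms(3) by (simp add: proj_eq_iff)
  then have "count {#proj p, proj q, R#} (proj p) = Polynomial.order 0 (fermat_on_line p w)"
    using line_section_count assms(2,3) p w by blast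
  then have "2 \<le> Polynomial.order 0 (fermat_on_line p w)"
    using True by simp
  then have "[:0, 1:] ^ 2 dvd fermat_on_line p w"
    using dvd_trans[OF le_imp_power_dvd order_1[of 0 "fermat_on_line p w"]] by simp
  moreover have "[:0, 1:] ^ 2 = [:0, 0, 1 :: complex:]"
    by (simp add: power2_eq_square)
  ultimately obtain k where "fermat_on_line p w = [:0, 0, 1:] * k"
    by (metis dvdE)
  then have eq: "fermat_on_line p w = pCons 0 (pCons 0 k)"
    by simp
  have "cubic p = 0" "polar p w = 0"
    using eq by (simp_all add: fermat_on_line_coeffs)
  then have "on_line (grad p) p" "on_line (grad p) w"
    by (simp_all add: on_line_grad polar_self)
  then have "cross (grad p) (cross p w) = 0" "cross a (cross p w) = 0"
    using line_through p w by blast+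
  then obtain c d where "cross p w = c *s grad p" "cross p w = d *s a"
    using parallel_imp_scale assms(1) grad_nonzero[OF assms(3)] by metis
  moreover have "c \<noteq> 0" using w(3) calculation by auto
  ultimately have "grad p = (d / c) *s a"
    by (simp add: vec3_eq_iff field_simps)
  then show ?thesis using True by (simp add: cross_scale_self)
next
  case False
  have "on_line a p" "on_line a q"
    using line_section_on_line[OF assms(2)] by auto
  then show ?thesis using False line_through by simp
qed

text \<open>With the uniqueness of the line, this makes the third point of the chord-tangent construction well
  defined; its existence comes from the explicit formulas below.\<close>

lemma cut_by_line_unique:
  assumes "cut_by_line {#P, Q, R#}" "cut_by_line {#P, Q, R'#}"
  shows "R = R'"
proof -
  from assms obtain a a' where a: "a \<noteq> 0" "line_section a {#P, Q, R#}"
    and a': "a' \<noteq> 0" "line_section a' {#P, Q, R'#}"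
    by (auto simp: cut_by_line_def)
  then have "P \<in> proj_plane" "Q \<in> proj_plane"
    by (auto simp: line_section_def)
  then obtain p q where pq: "p \<noteq> 0" "P = proj p" "q \<noteq> 0" "Q = proj q"
    by (auto simp: proj_plane_def)
  define l where "l = (if proj p = proj q then grad p else cross p q)"
  have "l \<noteq> 0"
    using grad_nonzero pq by (auto simp: l_def proj_eq_iff)
  moreover have "cross a l = 0" "cross a' l = 0"
    using line_of_section a a' pq unfolding l_def by blast+
  ultimately have "line_section l {#P, Q, R#}" "line_section l {#P, Q, R'#}"
    using line_section_parallel a a' by blast+
  then have "{#P, Q, R#} = {#P, Q, R'#}"
    using line_section_unique \<open>l \<noteq> 0\<close> by blast
  then show ?thesis by simp
qed

lemma third_point_eqI: "cut_by_line {#P, Q, R#} \<Longrightarrow> third_point P Q = R"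
  unfolding third_point_def by (rule the_equality) (assumption, rule cut_by_line_unique)

lemma order_linear:
  assumes "c \<noteq> 0 \<or> d \<noteq> (0::complex)"
  shows "Polynomial.order 0 [:c, d:] = (if c = 0 then 1 else 0)"
proof (cases "c = 0")
  case True
  have "Polynomial.order 0 [:0, 1::complex:] = 1"
    using order_power_n_n[of "0::complex" 1] by simp
  then show ?thesis using True assms order_smult[of d 0 "[:0, 1:]"] by simp
qed (auto intro: order_0I)

text \<open>On the line through \<open>p\<close> and \<open>q\<close>, with homogeneous coordinates \<open>(s : t)\<close>, the equation of
  the cubic becomes a binary cubic form; its three roots are the points cut out.\<close>

lemma line_section_of_factors:
  fixes p q :: "complex ^ 3" and s t :: "nat \<Rightarrow> complex"
  assumes pq: "cross p q \<noteq> 0" and k: "k \<noteq> 0"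
    and st: "\<And>i. i < 3 \<Longrightarrow> s i \<noteq> 0 \<or> t i \<noteq> 0"
    and factors: "\<And>x y. cubic (x *s p + y *s q) = k * (\<Prod>i<3. x * t i - y * s i)"
  shows "line_section (cross p q) (image_mset (\<lambda>i. proj (s i *s p + t i *s q)) (mset_set {..<3}))"
proof -
  let ?pt = "\<lambda>x y. x *s p + y *s q"
  have cross_pt: "cross (?pt x y) (?pt x' y') = (x * y' - y * x') *s cross p q" for x y x' y'
    by (simp add: vec3_eq_iff cross_components algebra_simps)
  have pt0: "?pt x y \<noteq> 0" if "x \<noteq> 0 \<or> y \<noteq> 0" for x y
  proof
    assume "?pt x y = 0"
    then have "cross (?pt x y) p = 0" "cross (?pt x y) q = 0"
      by (simp_all add: vec3_eq_iff cross_components)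
    moreover have "cross (?pt x y) p = (- y) *s cross p q" "cross (?pt x y) q = x *s cross p q"
      by (simp_all add: vec3_eq_iff cross_components algebra_simps)
    ultimately show False using that pq by auto
  qed
  have line_pt: "on_line (cross p q) (?pt x y)" for x y
    by (simp add: on_line_iff cross_components algebra_simps)
  let ?P = "\<lambda>i. proj (?pt (s i) (t i))"
  have count: "count (image_mset ?P (mset_set {..<3})) (proj v) =
      Polynomial.order 0 (fermat_on_line v w)"
    if vw: "v \<noteq> 0" "w \<noteq> 0" "proj v \<noteq> proj w" "on_line (cross p q) v" "on_line (cross p q) w"
    for v w
  proof -
    obtain x y where v: "v = ?pt x y" using in_span_if_on_line pq vw by blast
    obtain x' y' where w: "w = ?pt x' y'" using in_span_if_on_line pq vw by blast
    have indep: "x * y' - y * x' \<noteq> 0"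
      using vw(1-3) by (auto simp: proj_eq_iff v w cross_pt)
    define l where "l i = [:x * t i - y * s i, x' * t i - y' * s i:]" for i
    have nz: "x * t i - y * s i \<noteq> 0 \<or> x' * t i - y' * s i \<noteq> 0" if "i < 3" for i
    proof (rule ccontr)
      assume "\<not> ?thesis"
      then have *: "x * t i = y * s i" "x' * t i = y' * s i" by auto
      have "(x * y' - y * x') * t i = 0" "(x * y' - y * x') * s i = 0"
        using arg_cong2[OF *, of "\<lambda>u v. y' * u - y * v"] arg_cong2[OF *, of "\<lambda>u v. x' * u - x * v"]
        by (simp_all add: algebra_simps)
      then show False using indep st[OF that] by simp
    qed
    have "poly (fermat_on_line v w) z = poly (smult k (\<Prod>i<3. l i)) z" for z
    proof -
      have "v + z *s w = ?pt (x + z * x') (y + z * y')"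
        by (simp add: v w vec3_eq_iff algebra_simps)
      then have "poly (fermat_on_line v w) z =
          k * (\<Prod>i<3. (x + z * x') * t i - (y + z * y') * s i)"
        by (simp add: poly_fermat_on_line factors)
      then show ?thesis
        by (simp add: l_def poly_prod algebra_simps)
    qed
    then have "fermat_on_line v w = smult k (\<Prod>i<3. l i)"
      using poly_eq_poly_eq_iff by blast
    moreover have "l i \<noteq> 0" if "i < 3" for i
      using nz[OF that] by (auto simp: l_def)
    ultimately have "Polynomial.order 0 (fermat_on_line v w) = (\<Sum>i<3. Polynomial.order 0 (l i))"
      using k by (simp add: order_smult order_mult numeral_3_eq_3)
    also have "\<dots> = (\<Sum>i<3. if ?P i = proj v then 1 else 0)"
    proof (rule sum.cong)
      fix i assume "i \<in> {..<3::nat}"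
      then have i: "i < 3" by simp
      have "?P i = proj v \<longleftrightarrow> s i * y - t i * x = 0"
        using pt0[OF st[OF i]] vw(1) pq by (simp add: v proj_eq_iff cross_pt)
      also have "\<dots> \<longleftrightarrow> x * t i - y * s i = 0"
        by (auto simp: mult.commute)
      finally show "Polynomial.order 0 (l i) = (if ?P i = proj v then 1 else 0)"
        using order_linear[OF nz[OF i]] by (simp add: l_def)
    qed simp
    also have "\<dots> = count (image_mset ?P (mset_set {..<3})) (proj v)"
      by (simp add: numeral_3_eq_3 lessThan_Suc)
    finally show ?thesis by simp
  qed
  have "P \<in> proj_plane \<and> (\<forall>v\<in>P. on_line (cross p q) v)"
    if "P \<in># image_mset ?P (mset_set {..<3})" for P
  proof -
    obtain i where "i < 3" "P = ?P i" using \<open>P \<in># _\<close> by auto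
    then show ?thesis using pt0[OF st] line_pt on_line_proj by (auto simp: proj_plane_def)
  qed
  then show ?thesis
    using count unfolding line_section_def by blast
qed

lemma cut_by_line_of_factors:
  assumes "cross p q \<noteq> 0" "k \<noteq> 0"
    and "s\<^sub>0 \<noteq> 0 \<or> t\<^sub>0 \<noteq> 0" "s\<^sub>1 \<noteq> 0 \<or> t\<^sub>1 \<noteq> 0" "s\<^sub>2 \<noteq> 0 \<or> t\<^sub>2 \<noteq> 0"
    and "\<And>x y. cubic (x *s p + y *s q) =
      k * ((x * t\<^sub>0 - y * s\<^sub>0) * (x * t\<^sub>1 - y * s\<^sub>1) * (x * t\<^sub>2 - y * s\<^sub>2))"
  shows "cut_by_line {#proj (s\<^sub>0 *s p + t\<^sub>0 *s q), proj (s\<^sub>1 *s p + t\<^sub>1 *s q),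
    proj (s\<^sub>2 *s p + t\<^sub>2 *s q)#}"
proof -
  let ?s = "\<lambda>i::nat. if i = 0 then s\<^sub>0 else if i = 1 then s\<^sub>1 else s\<^sub>2"
  let ?t = "\<lambda>i::nat. if i = 0 then t\<^sub>0 else if i = 1 then t\<^sub>1 else t\<^sub>2"
  have "line_section (cross p q)
      (image_mset (\<lambda>i. proj (?s i *s p + ?t i *s q)) (mset_set {..<3}))"
    by (rule line_section_of_factors[OF assms(1,2)])
      (use assms in \<open>auto simp: numeral_3_eq_3 lessThan_Suc mult_ac\<close>)
  moreover have "image_mset (\<lambda>i. proj (?s i *s p + ?t i *s q)) (mset_set {..<3}) =
      {#proj (s\<^sub>0 *s p + t\<^sub>0 *s q), proj (s\<^sub>1 *s p + t\<^sub>1 *s q), proj (s\<^sub>2 *s p + t\<^sub>2 *s q)#}"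
    by (simp add: numeral_3_eq_3 lessThan_Suc add_mset_commute)
  ultimately show ?thesis using assms(1) by (auto simp: cut_by_line_def)
qed

text \<open>For \<open>p, q\<close> on the cubic, \<open>F(s p + t q) = 3 s t (s polar p q + t polar q p)\<close>; the third root of
  this form is \<open>(s : t) = (polar q p : - polar p q)\<close>.\<close>

lemma third_point_chord:
  assumes "p \<noteq> 0" "q \<noteq> 0" "cubic p = 0" "cubic q = 0" "proj p \<noteq> proj q"
  defines "r \<equiv> polar q p *s p - polar p q *s q"
  shows "third_point (proj p) (proj q) = proj r" "r \<noteq> 0" "cubic r = 0"
proof -
  have indep: "cross p q \<noteq> 0" using assms by (simp add: proj_eq_iff)
  have r: "r = polar q p *s p + (- polar p q) *s q"
    by (simp add: r_def vec3_eq_iff)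
  have nz: "polar q p \<noteq> 0 \<or> - polar p q \<noteq> 0"
    using not_contains_line indep assms by auto
  have "cut_by_line {#proj (1 *s p + 0 *s q), proj (0 *s p + 1 *s q),
      proj (polar q p *s p + (- polar p q) *s q)#}"
    by (rule cut_by_line_of_factors[OF indep, of 3])
      (use nz assms in \<open>auto simp: cubic_combination algebra_simps power2_eq_square\<close>)
  then show "third_point (proj p) (proj q) = proj r"
    by (intro third_point_eqI) (simp add: r)
  show "r \<noteq> 0"
  proof
    assume "r = 0"
    then have "cross r p = 0" "cross r q = 0" by (simp_all add: vec3_eq_iff cross_components)
    moreover have "cross r p = polar p q *s cross p q" "cross r q = polar q p *s cross p q"
      by (simp_all add: r_def vec3_eq_iff cross_components algebra_simps)
    ultimately show False using nz indep by auto
  qed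
  have "cubic (polar q p *s p + (- polar p q) *s q) = 0"
    using assms(3,4) by (subst cubic_combination) (simp add: algebra_simps power2_eq_square)
  then show "cubic r = 0" by (simp only: r)
qed


section \<open>Explicit formulas for the third point\<close>

text \<open>The classical doubling formula: the residual point of the tangent at \<open>p\<close>.\<close>

definition tangent_third :: "complex ^ 3 \<Rightarrow> complex ^ 3" where
  "tangent_third p = vec3 (p $ 1 * (p $ 2 ^ 3 - p $ 3 ^ 3)) (p $ 2 * (p $ 3 ^ 3 - p $ 1 ^ 3))
     (p $ 3 * (p $ 1 ^ 3 - p $ 2 ^ 3))"

lemma tangent_third_components:
  "tangent_third p $ 1 = p $ 1 * (p $ 2 ^ 3 - p $ 3 ^ 3)"
  "tangent_third p $ 2 = p $ 2 * (p $ 3 ^ 3 - p $ 1 ^ 3)"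
  "tangent_third p $ 3 = p $ 3 * (p $ 1 ^ 3 - p $ 2 ^ 3)"
  by (simp_all add: tangent_third_def)

text \<open>The last fact identifies the flexes: the tangent at \<open>p = (x, y, z)\<close> has its residual point at \<open>p\<close>
  itself exactly when \<open>x y z = 0\<close>, because \<open>p\<close> and the residual point have a cross product
  \<open>3 x y z (x\<^sup>2, y\<^sup>2, z\<^sup>2)\<close> modulo \<open>F\<close>.\<close>

lemma tangent_third_facts:
  assumes "p \<noteq> 0" "cubic p = 0"
  shows tangent_third_nonzero: "tangent_third p \<noteq> 0"
    and cubic_tangent_third: "cubic (tangent_third p) = 0"
    and polar_tangent_third: "polar p (tangent_third p) = 0"
    and flex_tangent_third: "cross p (tangent_third p) = 0 \<longleftrightarrow> p $ 1 * p $ 2 * p $ 3 = 0"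
proof -
  obtain x y z where xyz: "x = p $ 1" "y = p $ 2" "z = p $ 3" by blast
  have F: "x ^ 3 + y ^ 3 + z ^ 3 = 0" using assms(2) by (simp add: cubic_def xyz)
  have nz: "x \<noteq> 0 \<or> y \<noteq> 0 \<or> z \<noteq> 0" using assms(1) by (simp add: vec3_eq_iff xyz)
  show "tangent_third p \<noteq> 0"
  proof
    assume "tangent_third p = 0"
    then have e: "x = 0 \<or> y ^ 3 = z ^ 3" "y = 0 \<or> z ^ 3 = x ^ 3" "z = 0 \<or> x ^ 3 = y ^ 3"
      by (simp_all add: vec3_eq_iff tangent_third_components xyz)
    show False
    proof (cases "x = 0 \<or> y = 0")
      case True
      then show False using e F nz by auto
    next
      case False
      then have "y ^ 3 = x ^ 3" "z ^ 3 = x ^ 3" using e by auto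
      then have "x ^ 3 + x ^ 3 + x ^ 3 = 0" using F by simp
      then show False using False by simp
    qed
  qed
  have "cubic (tangent_third p) = (x ^ 3 + y ^ 3 + z ^ 3) *
      ((x ^ 3 - y ^ 3) * (y ^ 3 - z ^ 3) * (z ^ 3 - x ^ 3))"
    by (simp add: cubic_def tangent_third_components xyz[symmetric] power3_eq_cube algebra_simps)
  then show "cubic (tangent_third p) = 0" using F by simp
  show "polar p (tangent_third p) = 0"
    by (simp add: polar_def tangent_third_components power2_eq_square power3_eq_cube algebra_simps)
  have "cross p (tangent_third p) =
      (3 * (x * y * z)) *s vec3 (x ^ 2) (y ^ 2) (z ^ 2)"
  proof -
    have "y * (z * (x ^ 3 - y ^ 3)) - z * (y * (z ^ 3 - x ^ 3)) =
        3 * x * y * z * x ^ 2 - (x ^ 3 + y ^ 3 + z ^ 3) * (y * z)"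
      "z * (x * (y ^ 3 - z ^ 3)) - x * (z * (x ^ 3 - y ^ 3)) =
        3 * x * y * z * y ^ 2 - (x ^ 3 + y ^ 3 + z ^ 3) * (x * z)"
      "x * (y * (z ^ 3 - x ^ 3)) - y * (x * (y ^ 3 - z ^ 3)) =
        3 * x * y * z * z ^ 2 - (x ^ 3 + y ^ 3 + z ^ 3) * (x * y)"
      by (simp_all add: power2_eq_square power3_eq_cube algebra_simps)
    then show ?thesis
      by (simp add: vec3_eq_iff cross_components tangent_third_components xyz[symmetric] F)
  qed
  moreover have "vec3 (x ^ 2) (y ^ 2) (z ^ 2) \<noteq> 0" using nz by (auto simp: vec3_eq_iff)
  ultimately show "cross p (tangent_third p) = 0 \<longleftrightarrow> p $ 1 * p $ 2 * p $ 3 = 0"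
    by (simp add: xyz)
qed

text \<open>For \<open>p = (x, y, z)\<close> on the cubic and \<open>q = (u, v, w)\<close> on its tangent,
  \<open>y\<^sup>3 polar q p = - x z (z u - x w)\<^sup>2\<close>, and likewise with \<open>x\<^sup>3\<close> and \<open>z\<^sup>3\<close>. So at a point with a zero
  coordinate the restriction of \<open>F\<close> to the tangent is a cube.\<close>

lemma polar_flex:
  assumes "p \<noteq> 0" "cubic p = 0" "p $ 1 * p $ 2 * p $ 3 = 0" "polar p q = 0"
  shows "polar q p = 0"
proof -
  have id: "y ^ 3 * (u ^ 2 * x + v ^ 2 * y + w ^ 2 * z) = - (x * z * (z * u - x * w) ^ 2)"
    if F: "x ^ 3 + y ^ 3 + z ^ 3 = 0" and G: "x ^ 2 * u + y ^ 2 * v + z ^ 2 * w = 0"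
    for x y z u v w :: complex
  proof -
    have y3: "y ^ 3 = - (x ^ 3 + z ^ 3)" and y2: "y ^ 2 * v = - (x ^ 2 * u + z ^ 2 * w)"
      using F G by (simp_all add: eq_neg_iff_add_eq_0 algebra_simps)
    have "y ^ 3 * (u ^ 2 * x + v ^ 2 * y + w ^ 2 * z) = y ^ 3 * (u ^ 2 * x + w ^ 2 * z) + (y ^ 2 * v) ^ 2"
      by (simp add: power2_eq_square power3_eq_cube algebra_simps)
    also have "\<dots> = - (x * z * (z * u - x * w) ^ 2)"
      unfolding y3 y2 by (simp add: power2_eq_square power3_eq_cube algebra_simps)
    finally show ?thesis .
  qed
  obtain x y z where xyz: "x = p $ 1" "y = p $ 2" "z = p $ 3" by blast
  obtain u v w where uvw: "u = q $ 1" "v = q $ 2" "w = q $ 3" by blast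
  let ?B = "u ^ 2 * x + v ^ 2 * y + w ^ 2 * z"
  have F: "x ^ 3 + y ^ 3 + z ^ 3 = 0" using assms(2) by (simp add: cubic_def xyz)
  have G: "x ^ 2 * u + y ^ 2 * v + z ^ 2 * w = 0" using assms(4) by (simp add: polar_def xyz uvw)
  have "x * y * z = 0" using assms(3) by (simp add: xyz)
  moreover have "y ^ 3 * ?B = - (x * z * (z * u - x * w) ^ 2)" by (rule id[OF F G])
  moreover have "x ^ 3 * ?B = - (y * z * (z * v - y * w) ^ 2)"
    using id[of y x z v u w] F G by (simp add: algebra_simps)
  moreover have "z ^ 3 * ?B = - (x * y * (y * u - x * v) ^ 2)"
    using id[of x z y u w v] F G by (simp add: algebra_simps)
  moreover have "x \<noteq> 0 \<or> y \<noteq> 0 \<or> z \<noteq> 0" using assms(1) by (simp add: vec3_eq_iff xyz)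
  ultimately have "?B = 0" by auto
  then show ?thesis by (simp add: polar_def xyz uvw)
qed

lemma third_point_tangent:
  assumes "p \<noteq> 0" "cubic p = 0"
  shows "third_point (proj p) (proj p) = proj (tangent_third p)"
proof (cases "cross p (tangent_third p) = 0")
  case True
  have "on_line (grad p) p" using assms by (simp add: on_line_grad polar_self)
  then obtain q where q: "on_line (grad p) q" "cross p q \<noteq> 0"
    using second_point_on_line grad_nonzero assms(1) by metis
  have pq: "polar p q = 0" using q by (simp add: on_line_grad)
  moreover have qp: "polar q p = 0"
    using polar_flex assms pq True flex_tangent_third by blast
  ultimately have nz: "cubic q \<noteq> 0" using not_contains_line assms q(2) by blast
  have "cut_by_line {#proj (1 *s p + 0 *s q), proj (1 *s p + 0 *s q), proj (1 *s p + 0 *s q)#}"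
    by (rule cut_by_line_of_factors[OF q(2), of "- cubic q"])
      (use nz pq qp assms in \<open>auto simp: cubic_combination power3_eq_cube\<close>)
  then have "third_point (proj p) (proj p) = proj p"
    by (intro third_point_eqI) simp
  also have "\<dots> = proj (tangent_third p)"
    using True tangent_third_nonzero[OF assms] assms(1) by (simp add: proj_eq_iff)
  finally show ?thesis .
next
  case False
  let ?q = "tangent_third p"
  have pq: "polar p ?q = 0" "cubic ?q = 0"
    using polar_tangent_third cubic_tangent_third assms by blast+
  then have nz: "polar ?q p \<noteq> 0" using not_contains_line assms False by blast
  have "cut_by_line {#proj (1 *s p + 0 *s ?q), proj (1 *s p + 0 *s ?q), proj (0 *s p + 1 *s ?q)#}"
    by (rule cut_by_line_of_factors[OF False, of "3 * polar ?q p"])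
      (use nz pq assms in \<open>auto simp: cubic_combination power2_eq_square\<close>)
  then show ?thesis
    by (intro third_point_eqI) simp
qed

text \<open>On the cubic, \<open>rot\<close> is a translation by a point of order three. It is linear in the coordinates,
  which makes it a cheap means to move points into general position.\<close>

definition rot :: "complex ^ 3 \<Rightarrow> complex ^ 3" where
  "rot p = vec3 (p $ 2) (p $ 3) (p $ 1)"

text \<open>The addition formula of Hesse, for the residual point of a chord. With only two terms in each
  coordinate it makes associativity a manageable polynomial identity. The price is that it gives the
  zero vector for some pairs of points, among them all pairs of equal points.\<close>

definition hesse :: "complex ^ 3 \<Rightarrow> complex ^ 3 \<Rightarrow> complex ^ 3" where
  "hesse p q = vec3 (p $ 1 ^ 2 * q $ 2 * q $ 3 - q $ 1 ^ 2 * p $ 2 * p $ 3)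
     (p $ 2 ^ 2 * q $ 1 * q $ 3 - q $ 2 ^ 2 * p $ 1 * p $ 3)
     (p $ 3 ^ 2 * q $ 1 * q $ 2 - q $ 3 ^ 2 * p $ 1 * p $ 2)"

lemma rot_components: "rot p $ 1 = p $ 2" "rot p $ 2 = p $ 3" "rot p $ 3 = p $ 1"
  by (simp_all add: rot_def)

lemma hesse_components:
  "hesse p q $ 1 = p $ 1 ^ 2 * q $ 2 * q $ 3 - q $ 1 ^ 2 * p $ 2 * p $ 3"
  "hesse p q $ 2 = p $ 2 ^ 2 * q $ 1 * q $ 3 - q $ 2 ^ 2 * p $ 1 * p $ 3"
  "hesse p q $ 3 = p $ 3 ^ 2 * q $ 1 * q $ 2 - q $ 3 ^ 2 * p $ 1 * p $ 2"
  by (simp_all add: hesse_def)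

lemma rot3 [simp]: "rot (rot (rot p)) = p"
  by (simp add: vec3_eq_iff rot_components)

lemma rot_eq_0_iff [simp]: "rot p = 0 \<longleftrightarrow> p = 0"
  by (auto simp: vec3_eq_iff rot_components)

lemma cubic_rot [simp]: "cubic (rot p) = cubic p"
  by (simp add: cubic_def rot_components)

lemma rot_scale: "rot (c *s p) = c *s rot p"
  by (simp add: vec3_eq_iff rot_components)

lemma hesse_scale: "hesse (c *s p) (d *s q) = (c ^ 2 * d ^ 2) *s hesse p q"
  by (simp add: vec3_eq_iff hesse_components power2_eq_square algebra_simps)

lemma hesse_rot: "hesse (rot p) (rot q) = rot (hesse p q)"
  by (simp add: vec3_eq_iff hesse_components rot_components algebra_simps)

text \<open>Moving \<open>p\<close> by \<open>rot\<^sup>k\<close> moves the residual point by the inverse of \<open>rot\<^sup>k\<close>. Correcting for it gives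
  three formulas for the same point, and at most one of them degenerates at a given pair.\<close>

definition law :: "nat \<Rightarrow> complex ^ 3 \<Rightarrow> complex ^ 3 \<Rightarrow> complex ^ 3" where
  "law k p q = (rot ^^ k) (hesse ((rot ^^ k) p) q)"

lemma law_expand:
  "law 0 p q = hesse p q"
  "law (Suc 0) p q = rot (hesse (rot p) q)"
  "law 2 p q = rot (rot (hesse (rot (rot p)) q))"
  by (simp_all add: law_def numeral_2_eq_2)

text \<open>The common factor \<open>c\<close> is in the ideal of \<open>F(p), F(q)\<close>, so every formula gives, if not zero, the
  third point of the chord.\<close>

lemma chord_law_parallel:
  fixes p q :: "complex ^ 3"
  assumes "cubic p = 0" "cubic q = 0" "k < 3"
  shows "cross (polar q p *s p - polar p q *s q) (law k p q) = 0"
proof -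
  define c where "c = cubic p * (q $ 1 * q $ 2 * q $ 3) - cubic q * (p $ 1 * p $ 2 * p $ 3)"
  define d where "d = vec3 (p $ 1 * q $ 1) (p $ 2 * q $ 2) (p $ 3 * q $ 3)"
  have "cross (polar q p *s p - polar p q *s q) (law 0 p q) = c *s cross p q"
    "cross (polar q p *s p - polar p q *s q) (law (Suc 0) p q) = c *s d"
    "cross (polar q p *s p - polar p q *s q) (law 2 p q) = (- c) *s d"
    unfolding c_def d_def law_expand
    by (simp_all add: vec3_eq_iff cross_components hesse_components rot_components cubic_def
        polar_def power2_eq_square power3_eq_cube algebra_simps)
  moreover have "c = 0" using assms by (simp add: c_def)
  moreover have "k = 0 \<or> k = Suc 0 \<or> k = 2" using assms(3) by auto
  ultimately show ?thesis by auto
qed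

lemma tangent_law_parallel: "k < 3 \<Longrightarrow> cross (tangent_third p) (law k p p) = 0"
proof -
  assume "k < 3"
  then have "k = 0 \<or> k = Suc 0 \<or> k = 2" by auto
  moreover have "cross (tangent_third p) (law 0 p p) = 0" "cross (tangent_third p) (law (Suc 0) p p) = 0"
     "cross (tangent_third p) (law 2 p p) = 0"
    unfolding law_expand
    by (simp_all add: vec3_eq_iff cross_components hesse_components rot_components
        tangent_third_components power2_eq_square power3_eq_cube algebra_simps)
  ultimately show ?thesis by auto
qed

text \<open>Chords and tangents are treated together from here on: whatever the position of the two points,
  their third point is parallel to all three vectors \<open>law k p q\<close>.\<close>

lemma third_point_representative:
  assumes "p \<noteq> 0" "cubic p = 0" "q \<noteq> 0" "cubic q = 0"
  obtains r where "r \<noteq> 0" "cubic r = 0" "third_point (proj p) (proj q) = proj r"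
    "\<And>k. k < 3 \<Longrightarrow> cross r (law k p q) = 0"
proof (cases "proj p = proj q")
  case False
  then show ?thesis
    using third_point_chord[of p q] assms chord_law_parallel[of p q] that by blast
next
  case True
  then obtain c where c: "q = c *s p"
    using parallel_imp_scale assms proj_eq_iff by blast
  have "law k p q = c ^ 2 *s law k p p" for k
  proof -
    have "hesse r (c *s p) = c ^ 2 *s hesse r p" for r
      using hesse_scale[of 1 r c p] by simp
    moreover have "(rot ^^ k) (c ^ 2 *s r) = c ^ 2 *s (rot ^^ k) r" for r
      by (induction k) (simp_all add: rot_scale)
    ultimately show ?thesis by (simp add: law_def c)
  qed
  moreover have "cross r (d *s s) = d *s cross r s" for r s d
    by (simp add: vec3_eq_iff cross_components algebra_simps)
  ultimately have "cross (tangent_third p) (law k p q) = 0" if "k < 3" for k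
    using tangent_law_parallel that by simp
  then show ?thesis
    using that[of "tangent_third p"] tangent_third_nonzero[of p] cubic_tangent_third[of p]
      third_point_tangent[of p] assms True by simp
qed

lemma third_point_law:
  assumes "p \<noteq> 0" "cubic p = 0" "q \<noteq> 0" "cubic q = 0" "k < 3" "law k p q \<noteq> 0"
  shows "third_point (proj p) (proj q) = proj (law k p q)"
  using third_point_representative[OF assms(1-4)] assms(5,6) proj_eq_iff by metis

text \<open>If both formulas vanished, with nonzero coordinates, their quotients would give equal cubes
  \<open>x\<^sup>3 = y\<^sup>3 = z\<^sup>3\<close>, against \<open>x\<^sup>3 + y\<^sup>3 + z\<^sup>3 = 0\<close>.\<close>

lemma law_complete:
  assumes "p \<noteq> 0" "cubic p = 0" "q \<noteq> 0" "cubic q = 0"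
  shows "hesse p q \<noteq> 0 \<or> hesse (rot p) q \<noteq> 0"
proof (rule ccontr)
  obtain x y z where xyz: "x = p $ 1" "y = p $ 2" "z = p $ 3" by blast
  obtain u v w where uvw: "u = q $ 1" "v = q $ 2" "w = q $ 3" by blast
  have F: "x ^ 3 + y ^ 3 + z ^ 3 = 0" and G: "u ^ 3 + v ^ 3 + w ^ 3 = 0"
    using assms by (simp_all add: cubic_def xyz uvw)
  have nz: "x \<noteq> 0 \<or> y \<noteq> 0 \<or> z \<noteq> 0" "u \<noteq> 0 \<or> v \<noteq> 0 \<or> w \<noteq> 0"
    using assms by (simp_all add: vec3_eq_iff xyz uvw)
  assume "\<not> ?thesis"
  then have e: "x ^ 2 * v * w = u ^ 2 * y * z" "y ^ 2 * u * w = v ^ 2 * x * z"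
      "z ^ 2 * u * v = w ^ 2 * x * y" "y ^ 2 * v * w = u ^ 2 * z * x"
      "z ^ 2 * u * w = v ^ 2 * y * x" "x ^ 2 * u * v = w ^ 2 * y * z"
    by (simp_all add: vec3_eq_iff hesse_components rot_components xyz uvw)
  have x: "x \<noteq> 0" using e F G nz by (cases "x = 0"; cases "u = 0"; cases "v = 0") auto
  have y: "y \<noteq> 0" using e F G nz by (cases "y = 0"; cases "u = 0"; cases "v = 0") auto
  have z: "z \<noteq> 0" using e F G nz by (cases "z = 0"; cases "u = 0"; cases "v = 0") auto
  have uvw: "u \<noteq> 0 \<and> v \<noteq> 0 \<and> w \<noteq> 0"
    using e x y z nz by auto
  have "x ^ 2 * v * w * (u ^ 2 * z * x) = u ^ 2 * y * z * (y ^ 2 * v * w)"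
    using e by simp
  then have "x ^ 3 = y ^ 3" using uvw z by (simp add: power2_eq_square power3_eq_cube mult.assoc)
  moreover have "z ^ 2 * u * w * (v ^ 2 * x * z) = v ^ 2 * y * x * (y ^ 2 * u * w)"
    using e by simp
  then have "z ^ 3 = y ^ 3" using uvw x by (simp add: power2_eq_square power3_eq_cube mult.assoc)
  ultimately show False using F y by simp
qed


section \<open>The group law\<close>

text \<open>The involution \<open>P \<mapsto> - P\<close> for the group law with origin \<open>(1 : -1 : 0)\<close>.\<close>

definition swap :: "complex ^ 3 \<Rightarrow> complex ^ 3" where
  "swap p = vec3 (p $ 2) (p $ 1) (p $ 3)"

lemma swap_components: "swap p $ 1 = p $ 2" "swap p $ 2 = p $ 1" "swap p $ 3 = p $ 3"
  by (simp_all add: swap_def)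

lemma swap_swap [simp]: "swap (swap p) = p"
  by (simp add: vec3_eq_iff swap_components)

lemma swap_rot: "swap (rot p) = rot (rot (swap p))"
  by (simp add: vec3_eq_iff swap_components rot_components)

lemma swap_eq_0_iff [simp]: "swap p = 0 \<longleftrightarrow> p = 0"
  by (auto simp: vec3_eq_iff swap_components)

lemma cubic_swap [simp]: "cubic (swap p) = cubic p"
  by (simp add: cubic_def swap_components)

abbreviation turn :: "point \<Rightarrow> point" where "turn P \<equiv> rot ` P"
abbreviation flip :: "point \<Rightarrow> point" where "flip P \<equiv> swap ` P"

lemma turn_proj: "turn (proj p) = proj (rot p)"
  by (force simp: proj_def rot_scale)

lemma swap_scale: "swap (c *s p) = c *s swap p"
  by (simp add: vec3_eq_iff swap_components)

lemma flip_proj: "flip (proj p) = proj (swap p)"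
  by (force simp: proj_def swap_scale)

lemma flip_flip [simp]: "flip (flip P) = P"
  by (simp add: image_comp comp_def)

lemma turn3 [simp]: "turn (turn (turn P)) = P"
  by (simp add: image_comp comp_def)

lemma flip_turn: "flip (turn P) = turn (turn (flip P))"
  by (simp add: image_comp comp_def swap_rot)

lemma fermat_cubic_iff: "P \<in> fermat_cubic \<longleftrightarrow> (\<exists>p. p \<noteq> 0 \<and> cubic p = 0 \<and> P = proj p)"
proof -
  have "vanishes_at fermat_form (proj p) \<longleftrightarrow> cubic p = 0" for p
    using self_in_proj by (auto simp: vanishes_at_def value3_fermat proj_def cubic_scale)
  then show ?thesis by (auto simp: fermat_cubic_def proj_plane_def)
qed

lemma turn_closed: "P \<in> fermat_cubic \<Longrightarrow> turn P \<in> fermat_cubic"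
  by (metis fermat_cubic_iff turn_proj cubic_rot rot_eq_0_iff)

lemma flip_closed: "P \<in> fermat_cubic \<Longrightarrow> flip P \<in> fermat_cubic"
  by (metis fermat_cubic_iff flip_proj cubic_swap swap_eq_0_iff)

lemma third_point_closed:
  assumes "P \<in> fermat_cubic" "Q \<in> fermat_cubic"
  shows "third_point P Q \<in> fermat_cubic"
  using assms third_point_representative unfolding fermat_cubic_iff by metis

lemma third_point_commute: "third_point P Q = third_point Q P"
  by (simp add: third_point_def add_mset_commute)

text \<open>If \<open>turn\<close> is the translation by \<open>T\<close> with \<open>3 T = 0\<close>, this says \<open>- (P + T + Q) + T = - (P + Q)\<close>, but
  it has to be known before there is a group: it is the compatibility of the formulas \<open>law k\<close>.\<close>

lemma third_point_turn:
  assumes "P \<in> fermat_cubic" "Q \<in> fermat_cubic"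
  shows "turn (third_point (turn P) Q) = third_point P Q"
proof -
  obtain p q where p: "p \<noteq> 0" "cubic p = 0" "P = proj p" and q: "q \<noteq> 0" "cubic q = 0" "Q = proj q"
    using assms by (auto simp: fermat_cubic_iff)
  note law = third_point_law[OF _ _ q(1,2)]
  consider "hesse (rot p) q \<noteq> 0" | "hesse (rot (rot p)) q \<noteq> 0"
    using law_complete[of "rot p" q] p q by auto
  then show ?thesis
  proof cases
    case 1
    then have "third_point (proj (rot p)) (proj q) = proj (law 0 (rot p) q)"
      "third_point (proj p) (proj q) = proj (law (Suc 0) p q)"
      by (intro law; use p in \<open>simp add: law_expand\<close>)+
    then show ?thesis using p q by (simp add: turn_proj law_expand)
  next
    case 2
    then have "third_point (proj (rot p)) (proj q) = proj (law (Suc 0) (rot p) q)"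
      "third_point (proj p) (proj q) = proj (law 2 p q)"
      by (intro law; use p in \<open>simp add: law_expand\<close>)+
    then show ?thesis using p q by (simp add: turn_proj law_expand)
  qed
qed

definition chord_sum :: "point \<Rightarrow> point \<Rightarrow> point" where
  "chord_sum P Q = flip (third_point P Q)"

lemma chord_sum_closed:
  "P \<in> fermat_cubic \<Longrightarrow> Q \<in> fermat_cubic \<Longrightarrow> chord_sum P Q \<in> fermat_cubic"
  by (simp add: chord_sum_def third_point_closed flip_closed)

lemma chord_sum_commute: "chord_sum P Q = chord_sum Q P"
  by (simp add: chord_sum_def third_point_commute)

lemma chord_sum_turn:
  assumes "P \<in> fermat_cubic" "Q \<in> fermat_cubic"
  shows "chord_sum (turn P) Q = turn (chord_sum P Q)"
proof -
  have "flip (third_point P Q) = turn (turn (chord_sum (turn P) Q))"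
    using third_point_turn[OF assms] by (metis flip_turn chord_sum_def)
  then show ?thesis by (simp add: chord_sum_def)
qed

lemma turns_closed: "P \<in> fermat_cubic \<Longrightarrow> ((`) rot ^^ n) P \<in> fermat_cubic"
  by (induction n) (simp_all add: turn_closed)

lemma chord_sum_turns:
  assumes "P \<in> fermat_cubic" "Q \<in> fermat_cubic"
  shows "chord_sum (((`) rot ^^ m) P) (((`) rot ^^ n) Q) = ((`) rot ^^ (m + n)) (chord_sum P Q)"
proof -
  have left: "chord_sum (((`) rot ^^ m) P') Q' = ((`) rot ^^ m) (chord_sum P' Q')"
    if "P' \<in> fermat_cubic" "Q' \<in> fermat_cubic" for P' Q' m
    by (induction m) (simp_all add: that turns_closed chord_sum_turn)
  show ?thesis
    by (simp add: left turns_closed assms chord_sum_commute[of P] funpow_add)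
qed

lemma turns_inject: "((`) rot ^^ n) P = ((`) rot ^^ n) Q \<longleftrightarrow> P = Q"
proof -
  have "inj ((`) rot)" by (rule inj_on_inverseI[of _ "\<lambda>P. turn (turn P)"]) simp
  then show ?thesis using inj_fn injD by metis
qed

text \<open>Pairs of points to which the addition formula \<open>hesse\<close> itself applies. Among three translates of
  one of the points by \<open>turn\<close>, at least two make the pair generic (\<open>generic_cases\<close>).\<close>

definition generic :: "point \<Rightarrow> point \<Rightarrow> bool" where
  "generic P Q \<longleftrightarrow> (\<forall>p\<in>P. \<forall>q\<in>Q. hesse p q \<noteq> 0)"

lemma generic_proj: "generic (proj p) (proj q) \<longleftrightarrow> hesse p q \<noteq> 0"
  using self_in_proj[of p] self_in_proj[of q]
  by (auto simp: generic_def proj_def hesse_scale)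

lemma generic_turn: "generic (turn P) (turn Q) \<longleftrightarrow> generic P Q"
  by (simp add: generic_def hesse_rot)

lemma generic_turns: "generic (((`) rot ^^ (m + n)) P) (((`) rot ^^ n) Q) \<longleftrightarrow> generic (((`) rot ^^ m) P) Q"
  by (induction n) (simp_all add: generic_turn)

lemma generic_complete:
  assumes "P \<in> fermat_cubic" "Q \<in> fermat_cubic"
  shows "generic P Q \<or> generic (turn P) Q"
  using assms law_complete by (auto simp: fermat_cubic_iff turn_proj generic_proj)

lemma turns_mod_3: "((`) rot ^^ n) P = ((`) rot ^^ (n mod 3)) P"
  by (rule funpow_mod_eq[symmetric]) (simp add: numeral_3_eq_3)

lemma generic_cases:
  assumes "P \<in> fermat_cubic" "Q \<in> fermat_cubic" "m mod 3 \<noteq> n mod 3"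
  shows "generic (((`) rot ^^ m) P) Q \<or> generic (((`) rot ^^ n) P) Q"
proof -
  have step: "generic (((`) rot ^^ m) P) Q \<or> generic (((`) rot ^^ n) P) Q"
    if "n mod 3 = Suc m mod 3" for m n
  proof -
    have "generic (((`) rot ^^ m) P) Q \<or> generic (((`) rot ^^ Suc m) P) Q"
      using generic_complete[OF turns_closed[OF assms(1)] assms(2)] by simp
    moreover have "((`) rot ^^ n) P = ((`) rot ^^ Suc m) P"
      using that turns_mod_3 by metis
    ultimately show "generic (((`) rot ^^ m) P) Q \<or> generic (((`) rot ^^ n) P) Q" by simp
  qed
  have "n mod 3 = Suc m mod 3 \<or> m mod 3 = Suc n mod 3"
    using assms(3) mod_less_divisor[of 3 m] mod_less_divisor[of 3 n] unfolding mod_Suc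
    by (simp split: if_split) arith
  then show ?thesis using step by blast
qed

text \<open>Associativity in general position, before the final change of sign: the coordinates of this cross
  product, polynomials in nine variables, lie in the ideal of the three equations of the cubic.\<close>

lemma hesse_assoc:
  assumes "cubic p = 0" "cubic q = 0" "cubic r = 0"
  shows "cross (hesse p (swap (hesse q r))) (hesse (swap (hesse p q)) r) = 0" (is "?c = 0")
proof -
  have "?c $ 1 = 0"
    using assms unfolding cubic_def cross_components hesse_components swap_components
    by Groebner_Basis.algebra
  moreover have "?c $ 2 = 0"
    using assms unfolding cubic_def cross_components hesse_components swap_components
    by Groebner_Basis.algebra
  moreover have "?c $ 3 = 0"
    using assms unfolding cubic_def cross_components hesse_components swap_components
    by Groebner_Basis.algebra
  ultimately show ?thesis by (simp add: vec3_eq_iff)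
qed

lemma chord_sum_generic:
  assumes "p \<noteq> 0" "cubic p = 0" "q \<noteq> 0" "cubic q = 0" "hesse p q \<noteq> 0"
  shows "chord_sum (proj p) (proj q) = proj (swap (hesse p q))" "cubic (hesse p q) = 0"
proof -
  have law0: "law 0 p q = hesse p q" by (simp add: law_expand)
  show "chord_sum (proj p) (proj q) = proj (swap (hesse p q))"
    using third_point_law[OF assms(1-4), of 0] assms(5) by (simp add: chord_sum_def law0 flip_proj)
  obtain r where r: "r \<noteq> 0" "cubic r = 0" "cross r (law 0 p q) = 0"
    using third_point_representative[OF assms(1-4)] by (metis zero_less_numeral)
  then obtain c where "hesse p q = c *s r" using parallel_imp_scale law0 by metis
  then show "cubic (hesse p q) = 0" using r(2) by (simp add: cubic_scale)
qed

lemma chord_sum_assoc_generic: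
  assumes "P \<in> fermat_cubic" "Q \<in> fermat_cubic" "R \<in> fermat_cubic"
    and "generic P Q" "generic Q R" "generic (chord_sum P Q) R" "generic P (chord_sum Q R)"
  shows "chord_sum (chord_sum P Q) R = chord_sum P (chord_sum Q R)"
proof -
  obtain p q r where p: "p \<noteq> 0" "cubic p = 0" "P = proj p" and q: "q \<noteq> 0" "cubic q = 0" "Q = proj q"
    and r: "r \<noteq> 0" "cubic r = 0" "R = proj r"
    using assms(1-3) by (auto simp: fermat_cubic_iff)
  have pq: "hesse p q \<noteq> 0" and qr: "hesse q r \<noteq> 0"
    using assms(4,5) by (simp_all add: p q r generic_proj)
  let ?s = "swap (hesse p q)" and ?t = "swap (hesse q r)"
  have s: "chord_sum P Q = proj ?s" "?s \<noteq> 0" "cubic ?s = 0"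
    and t: "chord_sum Q R = proj ?t" "?t \<noteq> 0" "cubic ?t = 0"
    using chord_sum_generic[OF p(1,2) q(1,2) pq] chord_sum_generic[OF q(1,2) r(1,2) qr] pq qr
    by (simp_all add: p q r)
  have sr: "hesse ?s r \<noteq> 0" and pt: "hesse p ?t \<noteq> 0"
    using assms(6,7) unfolding s(1) t(1) by (simp_all add: p r generic_proj)
  have "proj (hesse p ?t) = proj (hesse ?s r)"
    using hesse_assoc p q r sr pt by (simp add: proj_eq_iff)
  then have "flip (proj (hesse p ?t)) = flip (proj (hesse ?s r))" by simp
  then show ?thesis
    using chord_sum_generic(1)[OF s(2,3) r(1,2) sr] chord_sum_generic(1)[OF p(1,2) t(2,3) pt]
    unfolding s(1) t(1) by (simp add: p r flip_proj)
qed

text \<open>Each of the two conditions fails for at most one of the three residues.\<close>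

lemma exists_common_residue:
  assumes "\<And>m n. m mod 3 \<noteq> n mod 3 \<Longrightarrow> A m \<or> A n" "\<And>m n. m mod 3 \<noteq> n mod 3 \<Longrightarrow> B m \<or> B n"
  shows "\<exists>n::nat. A n \<and> B n"
  using assms(1)[of 0 1] assms(1)[of 1 2] assms(1)[of 0 2] assms(2)[of 0 1] assms(2)[of 1 2]
    assms(2)[of 0 2] by auto

text \<open>Replacing \<open>P\<close> and \<open>Q\<close> by translates under \<open>turn\<close> changes both sides by the same translation, so it
  is enough to find translates for which all four additions are generic. Each addition excludes one
  residue for a linear form in the exponents. With \<open>Q\<close> moved by \<open>b\<close> and \<open>P\<close> by \<open>d + b\<close> the four forms
  are \<open>d, d\<close> and \<open>b, d + 2 b\<close>, so \<open>d\<close> and then \<open>b\<close> can be chosen.\<close>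

lemma chord_sum_assoc:
  assumes "P \<in> fermat_cubic" "Q \<in> fermat_cubic" "R \<in> fermat_cubic"
  shows "chord_sum (chord_sum P Q) R = chord_sum P (chord_sum Q R)"
proof -
  let ?T = "\<lambda>n. ((`) rot ^^ n)"
  let ?S = "chord_sum P Q" and ?U = "chord_sum Q R"
  have S: "?S \<in> fermat_cubic" and U: "?U \<in> fermat_cubic"
    using assms by (simp_all add: chord_sum_closed)
  have "\<exists>d. generic (?T d P) Q \<and> generic (?T d P) ?U"
    by (rule exists_common_residue[OF generic_cases[OF assms(1,2)] generic_cases[OF assms(1) U]])
  then obtain d where d: "generic (?T d P) Q" "generic (?T d P) ?U" by blast
  have "\<exists>b. generic (?T b Q) R \<and> generic (?T (d + b + b) ?S) R"
  proof (rule exists_common_residue)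
    fix m n :: nat assume mn: "m mod 3 \<noteq> n mod 3"
    then show "generic (?T m Q) R \<or> generic (?T n Q) R"
      by (rule generic_cases[OF assms(2,3)])
    \<comment> \<open>The residue of \<open>k\<close> is recovered from that of \<open>d + 2 k\<close>.\<close>
    have "k mod 3 = (2 * ((d + k + k) mod 3) + d) mod 3" for k
    proof -
      have "(2 * ((d + k + k) mod 3) + d) mod 3 = (2 * (d + k + k) + d) mod 3"
        by (metis mod_add_left_eq mod_mult_right_eq)
      also have "2 * (d + k + k) + d = k + (d + k) * 3" by simp
      finally show ?thesis by (simp only: mod_mult_self1)
    qed
    then have "(d + m + m) mod 3 \<noteq> (d + n + n) mod 3" using mn by metis
    then show "generic (?T (d + m + m) ?S) R \<or> generic (?T (d + n + n) ?S) R"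
      by (rule generic_cases[OF S assms(3)])
  qed
  then obtain b where b: "generic (?T b Q) R" "generic (?T (d + b + b) ?S) R" by blast
  let ?P = "?T (d + b) P" and ?Q = "?T b Q"
  have sums: "chord_sum ?P ?Q = ?T (d + b + b) ?S" "chord_sum ?Q R = ?T b ?U"
    using chord_sum_turns[of P Q "d + b" b] chord_sum_turns[of Q R b 0] assms by simp_all
  have "chord_sum (chord_sum ?P ?Q) R = chord_sum ?P (chord_sum ?Q R)"
    by (rule chord_sum_assoc_generic)
      (use assms b d in \<open>simp_all add: sums generic_turns turns_closed\<close>)
  moreover have "chord_sum (chord_sum ?P ?Q) R = ?T (d + b + b) (chord_sum ?S R)"
    using chord_sum_turns[of ?S R "d + b + b" 0] assms by (simp add: sums chord_sum_closed)
  moreover have "chord_sum ?P (chord_sum ?Q R) = ?T (d + b + b) (chord_sum P ?U)"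
    using chord_sum_turns[of P ?U "d + b" b] assms by (simp add: sums chord_sum_closed)
  ultimately show ?thesis by (simp add: turns_inject)
qed

definition flex_origin :: point where
  "flex_origin = proj (vec3 1 (-1) 0)"

lemma flex_origin_closed: "flex_origin \<in> fermat_cubic"
  unfolding fermat_cubic_iff flex_origin_def
  by (rule exI[of _ "vec3 1 (-1) 0"]) (simp add: vec3_eq_iff cubic_def)

lemma flip_flex_origin: "flip flex_origin = flex_origin"
  by (simp add: flex_origin_def flip_proj proj_eq_iff vec3_eq_iff swap_components cross_components)

text \<open>To identify a third point it suffices to see a common vector in the three formulas; that this
  vector is not zero and lies on the cubic comes for free from \<open>law_complete\<close>.\<close>

lemma third_point_eqI_law:
  assumes "p \<noteq> 0" "cubic p = 0" "q \<noteq> 0" "cubic q = 0"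
    and multiple: "\<And>k. k < 3 \<Longrightarrow> \<exists>c. law k p q = c *s r"
  shows "third_point (proj p) (proj q) = proj r" "r \<noteq> 0" "cubic r = 0"
proof -
  have "law 0 p q \<noteq> 0 \<or> law (Suc 0) p q \<noteq> 0"
    using law_complete[OF assms(1-4)] by (simp add: law_expand)
  then obtain k where k: "k < 3" "law k p q \<noteq> 0"
    by (metis zero_less_numeral less_Suc_eq_le numeral_3_eq_3 le_numeral_extra(3) less_SucI lessI)
  obtain c where c: "law k p q = c *s r" using multiple[OF k(1)] by blast
  then have "c \<noteq> 0" "r \<noteq> 0" using k(2) by auto
  then show "third_point (proj p) (proj q) = proj r"
    using third_point_law[OF assms(1-4) k] c by (simp add: proj_scale)
  show "r \<noteq> 0" by fact
  obtain s where s: "cubic s = 0" "s \<noteq> 0" "cross s (law k p q) = 0"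
    using third_point_representative[OF assms(1-4)] k(1) by metis
  then obtain d where "law k p q = d *s s" using parallel_imp_scale by blast
  then have "cubic (c *s r) = 0" using c s by (metis cubic_scale mult_zero_right)
  then show "cubic r = 0" using \<open>c \<noteq> 0\<close> by (simp add: cubic_scale)
qed

lemma less_3_cases: "k < 3 \<Longrightarrow> k = 0 \<or> k = Suc 0 \<or> k = (2::nat)"
  by auto

lemma chord_sum_origin:
  assumes "P \<in> fermat_cubic"
  shows "chord_sum flex_origin P = P"
proof -
  obtain p where p: "p \<noteq> 0" "cubic p = 0" "P = proj p" using assms by (auto simp: fermat_cubic_iff)
  let ?o = "vec3 1 (-1) 0"
  have "law 0 p ?o = (- (p $ 3)) *s swap p" "law (Suc 0) p ?o = (- (p $ 1)) *s swap p"
    "law 2 p ?o = (- (p $ 2)) *s swap p"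
    unfolding law_expand
    by (simp_all add: vec3_eq_iff hesse_components rot_components swap_components power2_eq_square)
  then have multiple: "\<exists>c. law k p ?o = c *s swap p" if "k < 3" for k
    using less_3_cases[OF that] by metis
  have "?o \<noteq> 0" "cubic ?o = 0" by (simp_all add: vec3_eq_iff cubic_def)
  then have "third_point P flex_origin = flip P"
    using third_point_eqI_law(1)[OF p(1,2) _ _ multiple] unfolding p(3) flex_origin_def flip_proj
    by blast
  then show ?thesis by (simp add: chord_sum_def third_point_commute[of flex_origin])
qed

lemma chord_sum_flip:
  assumes "P \<in> fermat_cubic"
  shows "chord_sum (flip P) P = flex_origin"
proof -
  obtain p where p: "p \<noteq> 0" "cubic p = 0" "P = proj p" using assms by (auto simp: fermat_cubic_iff)
  let ?o = "vec3 1 (-1) 0"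
  have "law 0 p (swap p) = (p $ 3 * (p $ 1 ^ 3 - p $ 2 ^ 3)) *s ?o"
    "law (Suc 0) p (swap p) = (p $ 2 * (p $ 3 ^ 3 - p $ 1 ^ 3)) *s ?o"
    "law 2 p (swap p) = (p $ 1 * (p $ 2 ^ 3 - p $ 3 ^ 3)) *s ?o"
    unfolding law_expand
    by (simp_all add: vec3_eq_iff hesse_components rot_components swap_components
        power2_eq_square power3_eq_cube algebra_simps)
  then have multiple: "\<exists>c. law k p (swap p) = c *s ?o" if "k < 3" for k
    using less_3_cases[OF that] by metis
  have "swap p \<noteq> 0" "cubic (swap p) = 0" using p by simp_all
  then have "third_point P (flip P) = flex_origin"
    using third_point_eqI_law(1)[OF p(1,2) _ _ multiple] unfolding p(3) flex_origin_def flip_proj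
    by blast
  then show ?thesis
    by (simp add: chord_sum_def third_point_commute[of "flip P"] flip_flex_origin)
qed

text \<open>The group law with one particular flex as origin. For every other flex the group differs from this
  one by a translation.\<close>

definition cubic_group :: "point monoid" where
  "cubic_group = \<lparr>carrier = fermat_cubic, monoid.mult = chord_sum, one = flex_origin\<rparr>"

lemma cubic_group_simps [simp]:
  "carrier cubic_group = fermat_cubic"
  "P \<otimes>\<^bsub>cubic_group\<^esub> Q = chord_sum P Q"
  "\<one>\<^bsub>cubic_group\<^esub> = flex_origin"
  by (simp_all add: cubic_group_def)

interpretation cubic_group: comm_group cubic_group
proof (rule comm_groupI)
  fix P assume "P \<in> carrier cubic_group"
  then show "\<exists>P'\<in>carrier cubic_group. P' \<otimes>\<^bsub>cubic_group\<^esub> P = \<one>\<^bsub>cubic_group\<^esub>"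
    using chord_sum_flip flip_closed by (intro bexI[of _ "flip P"]) simp_all
next
  fix P Q show "P \<otimes>\<^bsub>cubic_group\<^esub> Q = Q \<otimes>\<^bsub>cubic_group\<^esub> P"
    by (simp add: chord_sum_commute[of P Q])
qed (simp_all add: chord_sum_closed flex_origin_closed chord_sum_assoc chord_sum_origin)

lemma cubic_group_inv: "P \<in> fermat_cubic \<Longrightarrow> inv\<^bsub>cubic_group\<^esub> P = flip P"
  by (rule cubic_group.inv_equality) (simp_all add: chord_sum_flip flip_closed)


section \<open>Points of order nine\<close>

lemma chord_sum_self:
  assumes "p \<noteq> 0" "cubic p = 0"
  shows "chord_sum (proj p) (proj p) = proj (swap (tangent_third p))"
  using third_point_tangent[OF assms] by (simp add: chord_sum_def flip_proj)

text \<open>The points with \<open>3 P = 0\<close> are the flexes: \<open>3 P = 0\<close> means that the tangent at \<open>P\<close> has its residual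
  point at \<open>P\<close>.\<close>

lemma cube_eq_one_iff:
  assumes "p \<noteq> 0" "cubic p = 0"
  shows "proj p [^]\<^bsub>cubic_group\<^esub> (3::nat) = \<one>\<^bsub>cubic_group\<^esub> \<longleftrightarrow> p $ 1 * p $ 2 * p $ 3 = 0"
proof -
  have P: "proj p \<in> carrier cubic_group" using assms by (auto simp: fermat_cubic_iff)
  have "proj p [^]\<^bsub>cubic_group\<^esub> (3::nat) = chord_sum (chord_sum (proj p) (proj p)) (proj p)"
    using P by (simp add: numeral_3_eq_3 chord_sum_origin)
  also have "\<dots> = flex_origin \<longleftrightarrow> chord_sum (proj p) (proj p) = flip (proj p)"
    using P cubic_group.inv_equality[of "chord_sum (proj p) (proj p)" "proj p"]
      chord_sum_flip[of "proj p"]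
    by (auto simp: cubic_group_inv chord_sum_closed)
  also have "\<dots> \<longleftrightarrow> swap ` third_point (proj p) (proj p) = swap ` proj p"
    by (simp add: chord_sum_def)
  also have "\<dots> \<longleftrightarrow> third_point (proj p) (proj p) = proj p"
    by (metis flip_flip)
  also have "\<dots> \<longleftrightarrow> proj p = proj (tangent_third p)"
    by (auto simp: third_point_tangent[OF assms])
  also have "\<dots> \<longleftrightarrow> p $ 1 * p $ 2 * p $ 3 = 0"
    using tangent_third_nonzero[OF assms] flex_tangent_third[OF assms] assms(1)
    by (simp add: proj_eq_iff)
  finally show ?thesis by simp
qed

text \<open>The three factors of \<open>Q\<close>. They are stated over any commutative ring, because they are needed for
  numbers and for the variables of the polynomial ring.\<close>

definition Q1 :: "'a::comm_ring_1 \<Rightarrow> 'a \<Rightarrow> 'a" where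
  "Q1 x y = x ^ 9 - 3 * x ^ 6 * y ^ 3 - 6 * x ^ 3 * y ^ 6 - y ^ 9"
definition Q2 :: "'a::comm_ring_1 \<Rightarrow> 'a \<Rightarrow> 'a" where
  "Q2 x y = x ^ 6 + x ^ 3 * y ^ 3 + y ^ 6"
definition Q3 :: "'a::comm_ring_1 \<Rightarrow> 'a \<Rightarrow> 'a" where
  "Q3 x y = x ^ 9 + 6 * x ^ 6 * y ^ 3 + 3 * x ^ 3 * y ^ 6 - y ^ 9"

text \<open>Coordinates of the point \<open>- 3 P\<close>. Up to a constant their product is \<open>x y z Q(x, y)\<close>; this is where
  the form \<open>Q\<close> comes from.\<close>

definition triple_vec :: "complex ^ 3 \<Rightarrow> complex ^ 3" where
  "triple_vec p = vec3 (Q1 (p $ 1) (p $ 2)) (- Q3 (p $ 1) (p $ 2))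
     (- (3 * p $ 1 * p $ 2 * p $ 3 * Q2 (p $ 1) (p $ 2)))"

text \<open>The three addition formulas, applied to \<open>P\<close> and \<open>2 P\<close>, are \<open>z, y, x\<close> times \<open>triple_vec p\<close> modulo \<open>F\<close>.\<close>

lemma third_point_double:
  assumes "p \<noteq> 0" "cubic p = 0"
  shows "third_point (proj p) (proj (swap (tangent_third p))) = proj (triple_vec p)"
    "triple_vec p \<noteq> 0" "cubic (triple_vec p) = 0"
proof -
  let ?d = "swap (tangent_third p)"
  obtain x y z where xyz: "x = p $ 1" "y = p $ 2" "z = p $ 3" by blast
  have F: "x ^ 3 + y ^ 3 + z ^ 3 = 0" using assms(2) by (simp add: cubic_def xyz)
  have T: "triple_vec p = vec3 (Q1 x y) (- Q3 x y) (- (3 * x * y * z * Q2 x y))"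
    by (simp add: triple_vec_def xyz)
  have d: "?d $ 1 = y * (z ^ 3 - x ^ 3)" "?d $ 2 = x * (y ^ 3 - z ^ 3)" "?d $ 3 = z * (x ^ 3 - y ^ 3)"
    by (simp_all add: swap_components tangent_third_components xyz)
  note expand = vec3_eq_iff hesse_components rot_components d xyz[symmetric] T vector_3
    vector_smult_component Q1_def Q2_def Q3_def
  have "hesse p ?d = z *s triple_vec p"
    using F unfolding expand by (intro conjI; Groebner_Basis.algebra)
  moreover have "rot (hesse (rot p) ?d) = y *s triple_vec p"
    using F unfolding expand by (intro conjI; Groebner_Basis.algebra)
  moreover have "rot (rot (hesse (rot (rot p)) ?d)) = x *s triple_vec p"
    using F unfolding expand by (intro conjI; Groebner_Basis.algebra)
  ultimately have multiple: "\<exists>c. law k p ?d = c *s triple_vec p" if "k < 3" for k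
    using less_3_cases[OF that] law_expand by metis
  have "?d \<noteq> 0" "cubic ?d = 0"
    using tangent_third_nonzero[OF assms] cubic_tangent_third[OF assms] by simp_all
  then show "third_point (proj p) (proj ?d) = proj (triple_vec p)"
    "triple_vec p \<noteq> 0" "cubic (triple_vec p) = 0"
    using third_point_eqI_law[OF assms _ _ multiple] by blast+
qed

lemma cube_eq:
  assumes "p \<noteq> 0" "cubic p = 0"
  shows "proj p [^]\<^bsub>cubic_group\<^esub> (3::nat) = proj (swap (triple_vec p))"
proof -
  have P: "proj p \<in> carrier cubic_group" using assms by (auto simp: fermat_cubic_iff)
  have "proj p [^]\<^bsub>cubic_group\<^esub> (3::nat) = chord_sum (chord_sum (proj p) (proj p)) (proj p)"
    using P by (simp add: numeral_3_eq_3 chord_sum_origin)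
  also have "\<dots> = chord_sum (proj p) (proj (swap (tangent_third p)))"
    using chord_sum_self[OF assms] chord_sum_commute by simp
  also have "\<dots> = proj (swap (triple_vec p))"
    using third_point_double(1)[OF assms] by (simp add: chord_sum_def flip_proj)
  finally show ?thesis .
qed

definition Q_value :: "'a::comm_ring_1 \<Rightarrow> 'a \<Rightarrow> 'a" where
  "Q_value x y = Q1 x y * Q2 x y * Q3 x y"

text \<open>Since \<open>9 P = 3 (3 P)\<close>, the condition is that \<open>3 P\<close> is a flex, that is, that a coordinate of \<open>3 P\<close>
  is zero.\<close>

lemma ninth_power_eq_one_iff:
  assumes "p \<noteq> 0" "cubic p = 0"
  shows "proj p [^]\<^bsub>cubic_group\<^esub> (9::nat) = \<one>\<^bsub>cubic_group\<^esub> \<longleftrightarrow>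
    p $ 1 * p $ 2 * p $ 3 * Q_value (p $ 1) (p $ 2) = 0"
proof -
  have P: "proj p \<in> carrier cubic_group" using assms by (auto simp: fermat_cubic_iff)
  have "proj p [^]\<^bsub>cubic_group\<^esub> (9::nat) = (proj p [^]\<^bsub>cubic_group\<^esub> (3::nat)) [^]\<^bsub>cubic_group\<^esub> (3::nat)"
    using cubic_group.nat_pow_pow[OF P, of 3 3] by simp
  also have "\<dots> = proj (swap (triple_vec p)) [^]\<^bsub>cubic_group\<^esub> (3::nat)"
    using cube_eq[OF assms] by simp
  also have "\<dots> = \<one>\<^bsub>cubic_group\<^esub> \<longleftrightarrow> swap (triple_vec p) $ 1 * swap (triple_vec p) $ 2 * swap (triple_vec p) $ 3 = 0"
    using third_point_double(2,3)[OF assms] by (intro cube_eq_one_iff) simp_all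
  also have "\<dots> \<longleftrightarrow> p $ 1 * p $ 2 * p $ 3 * Q_value (p $ 1) (p $ 2) = 0"
    by (auto simp: swap_components triple_vec_def Q_value_def)
  finally show ?thesis .
qed

text \<open>Modulo \<open>F\<close> the form \<open>Q\<close> is symmetric in the three variables: the substitution
  \<open>z\<^sup>3 = - x\<^sup>3 - y\<^sup>3\<close> fixes the middle factor and exchanges the other two up to sign. The cofactor of
  \<open>F\<close> is made explicit because it has to lie in the polynomial ring over the small field.\<close>

definition Q_quot :: "'a::comm_ring_1 \<Rightarrow> 'a \<Rightarrow> 'a \<Rightarrow> 'a" where
  "Q_quot x y z =
    (2 * x ^ 6 + 4 * x ^ 3 * y ^ 3 + y ^ 3 * z ^ 3 - 5 * x ^ 3 * z ^ 3 - y ^ 6 - z ^ 6) * Q2 x z * Q3 x z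
    - Q3 x y * (z ^ 3 - y ^ 3) * Q3 x z
    - Q3 x y * Q2 x y * (2 * x ^ 6 + 4 * x ^ 3 * z ^ 3 + y ^ 3 * z ^ 3 - 5 * x ^ 3 * y ^ 3 - y ^ 6 - z ^ 6)"

lemma Q_value_diff:
  fixes x y z :: "'a::idom"
  shows "Q_value x z - Q_value x y = (x ^ 3 + y ^ 3 + z ^ 3) * Q_quot x y z"
proof -
  let ?F = "x ^ 3 + y ^ 3 + z ^ 3"
  have Q1: "Q1 x z = ?F *
      (2 * x ^ 6 + 4 * x ^ 3 * y ^ 3 + y ^ 3 * z ^ 3 - 5 * x ^ 3 * z ^ 3 - y ^ 6 - z ^ 6) - Q3 x y"
    and Q2: "Q2 x z = ?F * (z ^ 3 - y ^ 3) + Q2 x y"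
    and Q3: "Q3 x z = ?F *
      (2 * x ^ 6 + 4 * x ^ 3 * z ^ 3 + y ^ 3 * z ^ 3 - 5 * x ^ 3 * y ^ 3 - y ^ 6 - z ^ 6) - Q1 x y"
    unfolding Q1_def Q2_def Q3_def
    by (Groebner_Basis.algebra, Groebner_Basis.algebra, Groebner_Basis.algebra)
  define a b c where "a = Q1 x y" "b = Q2 x y" "c = Q3 x y"
  have "(?F * h - c) * (?F * k + b) * (?F * l - a) - a * b * c =
      ?F * (h * (?F * k + b) * (?F * l - a) - c * k * (?F * l - a) - c * b * l)" for h k l
    by (simp add: algebra_simps)
  then show ?thesis
    unfolding Q_value_def Q_quot_def Q1 Q2 Q3 a_b_c_def by blast
qed

lemma Q_value_commute: "Q_value y x = Q_value x y"
proof -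
  have "Q1 y x = - Q3 x y" "Q2 y x = Q2 x y" "Q3 y x = - Q1 x y"
    by (simp_all add: Q1_def Q2_def Q3_def algebra_simps)
  then show ?thesis by (simp add: Q_value_def mult_ac)
qed

text \<open>A type \<open>9\<close> point is not a flex: if \<open>x\<close> or \<open>y\<close> is zero then \<open>Q(x, y)\<close> is the 24th power of the other
  coordinate, and by symmetry the same holds for \<open>Q(x, z)\<close>.\<close>

lemma Q_value_imp_coordinates_nonzero:
  assumes "p \<noteq> 0" "cubic p = 0" "Q_value (p $ 1) (p $ 2) = 0"
  shows "p $ 1 \<noteq> 0" "p $ 2 \<noteq> 0" "p $ 3 \<noteq> 0"
proof -
  have F: "p $ 1 ^ 3 + p $ 2 ^ 3 + p $ 3 ^ 3 = 0" using assms by (simp add: cubic_def)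
  then have Qxz: "Q_value (p $ 1) (p $ 3) = 0" using Q_value_diff[of "p $ 1" "p $ 3" "p $ 2"] assms(3) by simp
  have eval: "Q_value 0 w = w ^ 24" "Q_value w 0 = w ^ 24" for w :: complex
    by (simp_all add: Q_value_def Q1_def Q2_def Q3_def flip: power_add)
  have nz: "\<not> (p $ 1 = 0 \<and> p $ 2 = 0 \<and> p $ 3 = 0)" using assms(1) by (simp add: vec3_eq_iff)
  show "p $ 1 \<noteq> 0"
    using eval assms(3) Qxz nz by auto
  then show "p $ 2 \<noteq> 0" "p $ 3 \<noteq> 0"
    using eval assms(3) Qxz by auto
qed

text \<open>In terms of the fixed group, the operation with origin \<open>e\<close> is \<open>P + Q - e\<close>.\<close>

lemma fermat_group_pow:
  assumes e: "e \<in> fermat_cubic" and P: "P \<in> fermat_cubic"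
  shows "P [^]\<^bsub>fermat_group e\<^esub> (n::nat) =
    (P \<otimes>\<^bsub>cubic_group\<^esub> inv\<^bsub>cubic_group\<^esub> e) [^]\<^bsub>cubic_group\<^esub> n \<otimes>\<^bsub>cubic_group\<^esub> e"
proof (induction n)
  case 0
  then show ?case using e by (simp add: fermat_group_def nat_pow_def chord_sum_origin)
next
  case (Suc n)
  let ?G = cubic_group
  let ?D = "P \<otimes>\<^bsub>?G\<^esub> inv\<^bsub>?G\<^esub> e"
  let ?W = "?D [^]\<^bsub>?G\<^esub> n"
  have c: "e \<in> carrier ?G" "P \<in> carrier ?G" using assms by simp_all
  then have D: "?D \<in> carrier ?G" "?W \<in> carrier ?G"
    by (metis cubic_group.m_closed cubic_group.inv_closed cubic_group.nat_pow_closed)+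
  have third: "third_point A B = inv\<^bsub>?G\<^esub> (A \<otimes>\<^bsub>?G\<^esub> B)" if "A \<in> fermat_cubic" "B \<in> fermat_cubic" for A B
    using that by (simp add: cubic_group_inv chord_sum_closed chord_sum_def third_point_closed flip_closed)
  have "P [^]\<^bsub>fermat_group e\<^esub> Suc n = third_point e (third_point (P [^]\<^bsub>fermat_group e\<^esub> n) P)"
    by (simp add: fermat_group_def nat_pow_def)
  also have "\<dots> = inv\<^bsub>?G\<^esub> (e \<otimes>\<^bsub>?G\<^esub> inv\<^bsub>?G\<^esub> ((?W \<otimes>\<^bsub>?G\<^esub> e) \<otimes>\<^bsub>?G\<^esub> P))"
    unfolding Suc using c D third cubic_group.m_closed cubic_group.inv_closed cubic_group_simps(1) by metis
  also have "\<dots> = inv\<^bsub>?G\<^esub> e \<otimes>\<^bsub>?G\<^esub> ((?W \<otimes>\<^bsub>?G\<^esub> e) \<otimes>\<^bsub>?G\<^esub> P)"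
    using c D by (simp add: cubic_group.inv_mult del: cubic_group_simps)
  also have "\<dots> = (?W \<otimes>\<^bsub>?G\<^esub> ?D) \<otimes>\<^bsub>?G\<^esub> e"
    using c D by (simp add: cubic_group.m_ac del: cubic_group_simps)
  also have "?W \<otimes>\<^bsub>?G\<^esub> ?D = ?D [^]\<^bsub>?G\<^esub> Suc n"
    using D by (simp del: cubic_group_simps)
  finally show ?case .
qed

lemma flex_cube:
  assumes "flex e"
  shows "e \<in> fermat_cubic" "e [^]\<^bsub>cubic_group\<^esub> (3::nat) = \<one>\<^bsub>cubic_group\<^esub>"
proof -
  show e: "e \<in> fermat_cubic" using assms by (simp add: flex_def)
  have "third_point e e = e" using third_point_eqI[of e e e] assms by (simp add: flex_def)
  then have "chord_sum (chord_sum e e) e = flex_origin"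
    using chord_sum_flip[OF e] by (simp add: chord_sum_def)
  then show "e [^]\<^bsub>cubic_group\<^esub> (3::nat) = \<one>\<^bsub>cubic_group\<^esub>"
    using e by (simp add: numeral_3_eq_3 chord_sum_origin)
qed

text \<open>A flex \<open>e\<close> has \<open>3 e = 0\<close>, so for \<open>n\<close> divisible by 3 the multiple of \<open>P\<close> with origin \<open>e\<close> is
  \<open>n P + e\<close>.\<close>

lemma fermat_group_pow_eq_one_iff:
  assumes e: "flex e" and P: "P \<in> fermat_cubic" and n: "3 dvd n"
  shows "P [^]\<^bsub>fermat_group e\<^esub> (n::nat) = \<one>\<^bsub>fermat_group e\<^esub> \<longleftrightarrow>
    P [^]\<^bsub>cubic_group\<^esub> n = \<one>\<^bsub>cubic_group\<^esub>"
proof -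
  let ?G = cubic_group
  have c: "e \<in> carrier ?G" "P \<in> carrier ?G" using flex_cube[OF e] P by simp_all
  obtain k where n: "n = 3 * k" using n by blast
  have "e [^]\<^bsub>?G\<^esub> n = \<one>\<^bsub>?G\<^esub>"
    using cubic_group.nat_pow_pow[OF c(1), of 3 k] flex_cube(2)[OF e] n
    by (metis cubic_group.nat_pow_one)
  then have "(P \<otimes>\<^bsub>?G\<^esub> inv\<^bsub>?G\<^esub> e) [^]\<^bsub>?G\<^esub> n = P [^]\<^bsub>?G\<^esub> n"
    using c by (simp add: cubic_group.nat_pow_distrib cubic_group.nat_pow_inv del: cubic_group_simps)
  then have "P [^]\<^bsub>fermat_group e\<^esub> n = P [^]\<^bsub>?G\<^esub> n \<otimes>\<^bsub>?G\<^esub> e"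
    using fermat_group_pow c by simp
  also have "\<dots> = e \<longleftrightarrow> P [^]\<^bsub>?G\<^esub> n = \<one>\<^bsub>?G\<^esub>"
    using cubic_group.r_cancel_one[of e "P [^]\<^bsub>?G\<^esub> n"] c cubic_group.nat_pow_closed by blast
  finally show ?thesis by (simp add: fermat_group_def)
qed

theorem type9_points_eq:
  assumes "flex e"
  shows "type9_points e = {proj p |p. p \<noteq> 0 \<and> cubic p = 0 \<and> Q_value (p $ 1) (p $ 2) = 0}"
proof -
  have "proj p \<in> type9_points e \<longleftrightarrow> Q_value (p $ 1) (p $ 2) = 0" if p: "p \<noteq> 0" "cubic p = 0" for p
  proof -
    have P: "proj p \<in> fermat_cubic" using p by (auto simp: fermat_cubic_iff)
    have carrier: "carrier (fermat_group e) = fermat_cubic" by (simp add: fermat_group_def)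
    have "proj p \<in> type9_points e \<longleftrightarrow>
        p $ 1 * p $ 2 * p $ 3 * Q_value (p $ 1) (p $ 2) = 0 \<and> p $ 1 * p $ 2 * p $ 3 \<noteq> 0"
      unfolding type9_points_def mem_Collect_eq carrier
      using fermat_group_pow_eq_one_iff[OF assms P, of 9] fermat_group_pow_eq_one_iff[OF assms P, of 3]
        ninth_power_eq_one_iff[OF p] cube_eq_one_iff[OF p] P by simp
    also have "\<dots> \<longleftrightarrow> Q_value (p $ 1) (p $ 2) = 0"
      using Q_value_imp_coordinates_nonzero[OF p] by auto
    finally show ?thesis .
  qed
  then have "P \<in> type9_points e \<longleftrightarrow> (\<exists>p. P = proj p \<and> p \<noteq> 0 \<and> cubic p = 0 \<and> Q_value (p $ 1) (p $ 2) = 0)"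
    if "P \<in> fermat_cubic" for P
    using that unfolding fermat_cubic_iff by metis
  moreover have "type9_points e \<subseteq> fermat_cubic"
    by (simp add: type9_points_def fermat_group_def)
  ultimately show ?thesis using fermat_cubic_iff by blast
qed


section \<open>Counting the points\<close>

lemma Q_value_expand:
  "Q_value x y = x ^ 24 + 4 * x ^ 21 * y ^ 3 - 17 * x ^ 18 * y ^ 6 - 65 * x ^ 15 * y ^ 9 -
    89 * x ^ 12 * y ^ 12 - 65 * x ^ 9 * y ^ 15 - 17 * x ^ 6 * y ^ 18 + 4 * x ^ 3 * y ^ 21 + y ^ 24"
  for x y :: "'a::idom"
  unfolding Q_value_def Q1_def Q2_def Q3_def by Groebner_Basis.algebra

lemma Q_value_scale: "Q_value (c * x) (c * y) = c ^ 24 * Q_value x y" for x y :: "'a::idom"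
  unfolding Q_value_def Q1_def Q2_def Q3_def by Groebner_Basis.algebra

definition Q_roots :: "complex set" where
  "Q_roots = {t. Q_value t 1 = 0}"

text \<open>\<open>Q(t, 1)\<close> as a polynomial in \<open>t\<^sup>3\<close>.\<close>

definition octic :: "complex poly" where
  "octic = [:1, 4, -17, -65, -89, -65, -17, 4, 1:]"

text \<open>Each factor has no multiple root, and no two factors have a common one; each of the six cases is an
  inconsistent pair of equations in one unknown.\<close>

lemma octic_squarefree: "\<not> (poly octic u = 0 \<and> poly (pderiv octic) u = 0)"
proof
  assume u: "poly octic u = 0 \<and> poly (pderiv octic) u = 0"
  define a b c a' b' c' where abc: "a = u ^ 3 - 3 * u ^ 2 - 6 * u - 1" "b = u ^ 2 + u + 1"
    "c = u ^ 3 + 6 * u ^ 2 + 3 * u - 1"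
    "a' = 3 * u ^ 2 - 6 * u - 6" "b' = 2 * u + 1" "c' = 3 * u ^ 2 + 12 * u + 3"
  have "poly octic u = a * b * c"
    unfolding octic_def abc by (simp add: algebra_simps power2_eq_square power3_eq_cube)
  moreover have "poly (pderiv octic) u = a' * b * c + a * b' * c + a * b * c'"
    unfolding octic_def abc
    by (simp add: pderiv_pCons algebra_simps power2_eq_square power3_eq_cube)
  ultimately have "a * b * c = 0" "a' * b * c + a * b' * c + a * b * c' = 0" using u by auto
  then consider "a = 0" "b = 0" | "a = 0" "c = 0" | "b = 0" "c = 0" | "a = 0" "a' = 0" | "b = 0" "b' = 0"
    | "c = 0" "c' = 0"
    by auto
  then show False
    by cases (unfold abc, Groebner_Basis.algebra+)
qed

lemma card_Q_roots: "finite Q_roots" "card Q_roots = 24"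
proof -
  define p where "p = pcompose octic [:0, 0, 0, 1:]"
  have poly_p: "poly p t = Q_value t 1" for t
    by (simp add: p_def poly_pcompose octic_def Q_value_expand power3_eq_cube eval_nat_numeral algebra_simps)
  have "degree octic = 8" by (simp add: octic_def)
  then have degree: "degree p = 24" by (simp add: p_def degree_pcompose)
  then have "p \<noteq> 0" by auto
  have "\<not> (poly p t = 0 \<and> poly (pderiv p) t = 0)" for t
  proof (cases "t = 0")
    case True
    then show ?thesis by (simp add: poly_p Q_value_expand)
  next
    case False
    then show ?thesis
      using octic_squarefree[of "t ^ 3"]
      by (auto simp: p_def pderiv_pcompose poly_pcompose pderiv_pCons power3_eq_cube mult.assoc)
  qed
  then have "rsquarefree p" by (simp add: rsquarefree_roots)
  then have "p = smult (lead_coeff p) (\<Prod>z|poly p z = 0. [:-z, 1:])"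
    by (simp add: complex_poly_decompose_rsquarefree)
  then have "degree p = degree (\<Prod>z|poly p z = 0. [:-z, 1:])"
    using \<open>p \<noteq> 0\<close> by (metis degree_smult_eq leading_coeff_0_iff)
  also have "\<dots> = card {z. poly p z = 0}"
    by (subst degree_prod_sum_eq) simp_all
  finally have "card {z. poly p z = 0} = 24" using degree by simp
  then show "card Q_roots = 24" by (simp add: Q_roots_def poly_p)
  then show "finite Q_roots" using card.infinite by force
qed

definition type9_set :: "point set" where
  "type9_set = {proj p |p. p \<noteq> 0 \<and> cubic p = 0 \<and> Q_value (p $ 1) (p $ 2) = 0}"

text \<open>The points are \<open>(t : 1 : z)\<close> for the 24 roots \<open>t\<close> of \<open>Q(t, 1)\<close> and the three cube roots \<open>z\<close> of
  \<open>- (t\<^sup>3 + 1)\<close>, which is not zero as \<open>z\<close> is not.\<close>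

lemma card_type9_set: "card type9_set = 72"
proof -
  define A where "A = (SIGMA t:Q_roots. {z. z ^ 3 = - (t ^ 3 + 1)})"
  define f where "f = (\<lambda>(t, z). proj (vec3 t 1 z))"
  have nz: "vec3 t 1 z \<noteq> 0" for t z by (simp add: vec3_eq_iff)
  have cubic: "cubic (vec3 t 1 z) = 0 \<longleftrightarrow> z ^ 3 = - (t ^ 3 + 1)" for t z
    by (auto simp: cubic_def eq_neg_iff_add_eq_0 algebra_simps)
  have "card {z. z ^ 3 = - (t ^ 3 + 1)} = 3" if "t \<in> Q_roots" for t
  proof (rule card_nth_roots)
    show "- (t ^ 3 + 1) \<noteq> 0"
      using Q_value_imp_coordinates_nonzero(3)[OF nz, of t 0] that cubic[of t 0]
      by (auto simp: Q_roots_def)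
  qed simp
  then have "card A = 72"
    unfolding A_def by (subst card_SigmaI) (auto simp: card_Q_roots intro: card_ge_0_finite)
  moreover have "inj_on f A"
    by (auto simp: inj_on_def f_def proj_eq_iff nz vec3_eq_iff cross_components)
  moreover have "f ` A = type9_set"
  proof
    show "f ` A \<subseteq> type9_set"
      using nz cubic by (force simp: f_def A_def type9_set_def Q_roots_def)
    show "type9_set \<subseteq> f ` A"
    proof
      fix P assume "P \<in> type9_set"
      then obtain p where p: "p \<noteq> 0" "cubic p = 0" "Q_value (p $ 1) (p $ 2) = 0" "P = proj p"
        by (auto simp: type9_set_def)
      then have y: "p $ 2 \<noteq> 0" using Q_value_imp_coordinates_nonzero by blast
      define t z where "t = p $ 1 / p $ 2" "z = p $ 3 / p $ 2"
      have ps: "p = p $ 2 *s vec3 t 1 z" using y by (simp add: vec3_eq_iff t_z_def)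
      then have "P = proj (vec3 t 1 z)" using p(4) y proj_scale by metis
      moreover have "Q_value t 1 = 0"
        using Q_value_scale[of "p $ 2" t 1] p(3) y by (simp add: t_z_def)
      moreover have "cubic (vec3 t 1 z) = 0"
        using p(2) ps y by (metis cubic_scale mult_eq_0_iff power_eq_0_iff)
      ultimately show "P \<in> f ` A" using cubic by (force simp: f_def A_def Q_roots_def)
    qed
  qed
  ultimately show ?thesis by (metis card_image)
qed


section \<open>Ideals of ternary polynomials over a subring\<close>

text \<open>Over any subring of the complex numbers the argument is the same: \<open>F\<close> is monic in \<open>z\<close> and \<open>Q\<close> is
  monic in \<open>x\<close>, and so division with remainder does not leave the subring.\<close>

locale coeff_subring =
  fixes K :: "complex set"
  assumes one_in: "1 \<in> K"
    and add_in: "a \<in> K \<Longrightarrow> b \<in> K \<Longrightarrow> a + b \<in> K"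
    and mult_in: "a \<in> K \<Longrightarrow> b \<in> K \<Longrightarrow> a * b \<in> K"
    and uminus_in: "a \<in> K \<Longrightarrow> - a \<in> K"
begin

lemma zero_in: "0 \<in> K"
  using add_in[OF one_in uminus_in[OF one_in]] by simp

abbreviation "R \<equiv> poly_ring3 K"

lemma R_simps [simp]:
  "f \<otimes>\<^bsub>R\<^esub> g = f * g" "f \<oplus>\<^bsub>R\<^esub> g = f + g" "\<one>\<^bsub>R\<^esub> = 1" "\<zero>\<^bsub>R\<^esub> = 0"
  by (simp_all add: poly_ring3_def ring_of_type_algebra_def)

lemma carrier_iff: "f \<in> carrier R \<longleftrightarrow> (\<forall>m. Poly_Mapping.lookup f m \<in> K)"
  by (simp add: poly_ring3_def)

lemma single_closed: "c \<in> K \<Longrightarrow> Poly_Mapping.single m c \<in> carrier R"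
  by (simp add: carrier_iff lookup_single when_def zero_in)

lemma zero_closed: "0 \<in> carrier R"
  by (simp add: carrier_iff zero_in)

lemma one_closed: "1 \<in> carrier R"
  using single_closed[OF one_in, of 0] by simp

lemma add_closed: "f \<in> carrier R \<Longrightarrow> g \<in> carrier R \<Longrightarrow> f + g \<in> carrier R"
  by (simp add: carrier_iff lookup_add add_in)

lemma uminus_closed: "f \<in> carrier R \<Longrightarrow> - f \<in> carrier R"
  by (simp add: carrier_iff uminus_in)

lemma diff_closed: "f \<in> carrier R \<Longrightarrow> g \<in> carrier R \<Longrightarrow> f - g \<in> carrier R"
  using add_closed[OF _ uminus_closed] by fastforce

lemma sum_closed: "(\<And>a. a \<in> A \<Longrightarrow> F a \<in> carrier R) \<Longrightarrow> sum F A \<in> carrier R"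
  by (induction A rule: infinite_finite_induct) (auto simp: zero_closed add_closed)

lemma mult_closed: "f * g \<in> carrier R" if "f \<in> carrier R" "g \<in> carrier R"
proof -
  let ?f = "Poly_Mapping.lookup f" and ?g = "Poly_Mapping.lookup g"
  have "f * g = (\<Sum>m\<in>Poly_Mapping.keys f. Poly_Mapping.single m (?f m)) *
      (\<Sum>n\<in>Poly_Mapping.keys g. Poly_Mapping.single n (?g n))"
    by (rule arg_cong2[OF poly_mapping_eq_sum_singles poly_mapping_eq_sum_singles])
  also have "\<dots> = (\<Sum>m\<in>Poly_Mapping.keys f. \<Sum>n\<in>Poly_Mapping.keys g.
      Poly_Mapping.single (m + n) (?f m * ?g n))"
    by (simp add: sum_product Poly_Mapping.mult_single)
  also have "\<dots> \<in> carrier R"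
    using that by (intro sum_closed single_closed mult_in) (simp_all add: carrier_iff)
  finally show ?thesis .
qed

lemma power_closed: "f \<in> carrier R \<Longrightarrow> f ^ n \<in> carrier R"
  by (induction n) (auto simp: one_closed mult_closed)

lemma var_closed: "var3 i \<in> carrier R"
  unfolding var3_def by (rule single_closed[OF one_in])

lemma of_nat_closed: "of_nat n \<in> carrier R"
  by (induction n) (auto simp: zero_closed one_closed add_closed)

lemma numeral_closed: "numeral n \<in> carrier R"
  using of_nat_closed[of "numeral n"] by simp

lemmas closed = zero_closed one_closed add_closed diff_closed mult_closed power_closed var_closed
  numeral_closed

lemma cring_R: "cring R"
proof (rule cringI)
  show "abelian_group R"
  proof (rule abelian_groupI)
    fix f assume "f \<in> carrier R"
    then show "\<exists>g\<in>carrier R. g \<oplus>\<^bsub>R\<^esub> f = \<zero>\<^bsub>R\<^esub>"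
      by (intro bexI[of _ "- f"]) (simp_all add: uminus_closed)
  qed (simp_all add: closed ac_simps)
  show "comm_monoid R"
    by (rule comm_monoidI) (simp_all add: closed ac_simps)
qed (simp add: distrib_right)

lemma genideal_pair:
  assumes f: "f \<in> carrier R" and g: "g \<in> carrier R"
  shows "Idl\<^bsub>R\<^esub> {f, g} = {f * a + g * b |a b. a \<in> carrier R \<and> b \<in> carrier R}" (is "_ = ?I")
proof -
  interpret R: cring R by (rule cring_R)
  have "ideal ?I R"
  proof (rule idealI)
    show "subgroup ?I (add_monoid R)"
    proof
      show "?I \<subseteq> carrier (add_monoid R)" using f g by (auto simp: closed)
      show "x \<otimes>\<^bsub>add_monoid R\<^esub> y \<in> ?I" if "x \<in> ?I" "y \<in> ?I" for x y
      proof -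
        from that obtain a b a' b' where "a \<in> carrier R" "b \<in> carrier R" "a' \<in> carrier R" "b' \<in> carrier R"
          "x = f * a + g * b" "y = f * a' + g * b'" by blast
        then show ?thesis
          by (intro CollectI exI[of _ "a + a'"] exI[of _ "b + b'"]) (simp add: closed algebra_simps)
      qed
      show "\<one>\<^bsub>add_monoid R\<^esub> \<in> ?I"
        by (intro CollectI exI[of _ 0]) (simp add: closed)
      show "inv\<^bsub>add_monoid R\<^esub> x \<in> ?I" if "x \<in> ?I" for x
      proof -
        from that obtain a b where ab: "a \<in> carrier R" "b \<in> carrier R" "x = f * a + g * b" by blast
        have "\<ominus>\<^bsub>R\<^esub> x = - x"
          using ab f g by (intro R.minus_equality) (simp_all add: closed uminus_closed)
        then show ?thesis
          using ab unfolding a_inv_def[symmetric]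
          by (intro CollectI exI[of _ "- a"] exI[of _ "- b"]) (simp add: uminus_closed)
      qed
    qed
    show "x \<otimes>\<^bsub>R\<^esub> a \<in> ?I" if "a \<in> ?I" "x \<in> carrier R" for a x
    proof -
      from that obtain c d where "c \<in> carrier R" "d \<in> carrier R" "a = f * c + g * d" by blast
      then show ?thesis using that(2)
        by (intro CollectI exI[of _ "x * c"] exI[of _ "x * d"]) (simp add: closed algebra_simps)
    qed
    then show "a \<otimes>\<^bsub>R\<^esub> x \<in> ?I" if "a \<in> ?I" "x \<in> carrier R" for a x
      using that by (simp add: mult.commute)
  qed (rule R.ring_axioms)
  moreover have "{f, g} \<subseteq> ?I"
  proof -
    have "f = f * 1 + g * 0" "g = f * 0 + g * 1" by simp_all
    then show ?thesis using one_closed zero_closed by blast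
  qed
  ultimately have "Idl\<^bsub>R\<^esub> {f, g} \<subseteq> ?I"
    by (rule R.genideal_minimal)
  moreover have "?I \<subseteq> Idl\<^bsub>R\<^esub> {f, g}"
  proof -
    have fg: "{f, g} \<subseteq> carrier R" using f g by simp
    interpret I: ideal "Idl\<^bsub>R\<^esub> {f, g}" R by (rule R.genideal_ideal[OF fg])
    have "f \<in> Idl\<^bsub>R\<^esub> {f, g}" "g \<in> Idl\<^bsub>R\<^esub> {f, g}"
      using R.genideal_self[OF fg] by simp_all
    then have "f \<otimes>\<^bsub>R\<^esub> a \<oplus>\<^bsub>R\<^esub> g \<otimes>\<^bsub>R\<^esub> b \<in> Idl\<^bsub>R\<^esub> {f, g}"
      if "a \<in> carrier R" "b \<in> carrier R" for a b
      using that by (intro I.a_closed I.I_r_closed)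
    then show ?thesis by auto
  qed
  ultimately show ?thesis by blast
qed

lemma genideal_single:
  assumes "f \<in> carrier R"
  shows "Idl\<^bsub>R\<^esub> {f} = {f * a |a. a \<in> carrier R}"
proof -
  have "Idl\<^bsub>R\<^esub> {f, f} = {f * a + f * b |a b. a \<in> carrier R \<and> b \<in> carrier R}"
    by (rule genideal_pair[OF assms assms])
  also have "\<dots> = {f * a |a. a \<in> carrier R}"
  proof (intro equalityI subsetI)
    fix h assume "h \<in> {f * a + f * b |a b. a \<in> carrier R \<and> b \<in> carrier R}"
    then obtain a b where "a \<in> carrier R" "b \<in> carrier R" "h = f * (a + b)"
      by (auto simp: distrib_left)
    then show "h \<in> {f * a |a. a \<in> carrier R}" using add_closed by blast
  next
    fix h assume "h \<in> {f * a |a. a \<in> carrier R}"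
    then obtain a where "a \<in> carrier R" "h = f * a + f * 0" by auto
    then show "h \<in> {f * a + f * b |a b. a \<in> carrier R \<and> b \<in> carrier R}" using zero_closed by blast
  qed
  finally show ?thesis by simp
qed

text \<open>Used to replace \<open>Q(x, y)\<close> by \<open>Q(x, z)\<close> or \<open>Q(y, z)\<close>.\<close>

lemma genideal_pair_cong:
  assumes "f \<in> carrier R" "g \<in> carrier R" "h \<in> carrier R" "g' - g = f * h"
  shows "Idl\<^bsub>R\<^esub> {f, g'} = Idl\<^bsub>R\<^esub> {f, g}"
proof -
  have g': "g' = g + f * h" using assms(4) by (simp add: algebra_simps)
  have g'_closed: "g' \<in> carrier R" using assms by (simp add: g' closed)
  show ?thesis
    unfolding genideal_pair[OF assms(1) g'_closed] genideal_pair[OF assms(1,2)]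
  proof (intro equalityI subsetI; elim CollectE exE conjE)
    fix u a b assume ab: "u = f * a + g' * b" "a \<in> carrier R" "b \<in> carrier R"
    then show "u \<in> {f * a + g * b |a b. a \<in> carrier R \<and> b \<in> carrier R}"
      using assms(3) by (intro CollectI exI[of _ "a + h * b"] exI[of _ b])
        (simp add: g' closed algebra_simps)
  next
    fix u a b assume ab: "u = f * a + g * b" "a \<in> carrier R" "b \<in> carrier R"
    then show "u \<in> {f * a + g' * b |a b. a \<in> carrier R \<and> b \<in> carrier R}"
      using assms(3) by (intro CollectI exI[of _ "a - h * b"] exI[of _ b])
        (simp add: g' closed algebra_simps)
  qed
qed

end

section \<open>Division by the two forms\<close>

abbreviation "Qxy \<equiv> Q_form x_var y_var"

lemma Q_form_eq: "Q_form p q = Q_value p q"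
  by (simp add: Q_form_def Q_value_def Q1_def Q2_def Q3_def)

definition mono3 :: "complex \<Rightarrow> nat \<Rightarrow> nat \<Rightarrow> nat \<Rightarrow> poly3" where
  "mono3 c i j k = Poly_Mapping.single 0 c * x_var ^ i * y_var ^ j * z_var ^ k"

lemma var3_power: "var3 i ^ n = Poly_Mapping.single (Poly_Mapping.single i n) 1"
  by (induction n) (simp_all add: var3_def Poly_Mapping.mult_single single_add[symmetric])

lemma mono3_single: "mono3 c i j k = Poly_Mapping.single
    (Poly_Mapping.single 1 i + Poly_Mapping.single 2 j + Poly_Mapping.single 3 k) c"
  by (simp add: mono3_def var3_power Poly_Mapping.mult_single)

lemma single_mono3: "Poly_Mapping.single m c =
    mono3 c (Poly_Mapping.lookup m 1) (Poly_Mapping.lookup m 2) (Poly_Mapping.lookup m 3)"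
proof -
  have "m = Poly_Mapping.single 1 (Poly_Mapping.lookup m 1) +
      Poly_Mapping.single 2 (Poly_Mapping.lookup m 2) + Poly_Mapping.single 3 (Poly_Mapping.lookup m 3)"
  proof (rule poly_mapping_eqI)
    fix i :: 3
    show "Poly_Mapping.lookup m i = Poly_Mapping.lookup (Poly_Mapping.single 1 (Poly_Mapping.lookup m 1) +
      Poly_Mapping.single 2 (Poly_Mapping.lookup m 2) + Poly_Mapping.single 3 (Poly_Mapping.lookup m 3)) i"
      using exhaust_3[of i] by (auto simp: lookup_add lookup_single when_def)
  qed
  then show ?thesis by (simp add: mono3_single)
qed

text \<open>The remainders: degree less than 3 in \<open>z\<close> after division by \<open>F\<close>, and then also degree less than 24
  in \<open>x\<close> after division by \<open>Q(x, y)\<close>, which does not involve \<open>z\<close>.\<close>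

definition reduced_z :: "poly3 \<Rightarrow> bool" where
  "reduced_z f \<longleftrightarrow> (\<forall>m\<in>Poly_Mapping.keys f. Poly_Mapping.lookup m 3 < 3)"

definition reduced_x :: "poly3 \<Rightarrow> bool" where
  "reduced_x f \<longleftrightarrow> (\<forall>m\<in>Poly_Mapping.keys f. Poly_Mapping.lookup m 1 < 24)"

lemma reduced_add:
  "reduced_z f \<Longrightarrow> reduced_z g \<Longrightarrow> reduced_z (f + g)"
  "reduced_x f \<Longrightarrow> reduced_x g \<Longrightarrow> reduced_x (f + g)"
  using Poly_Mapping.keys_add[of f g] unfolding reduced_z_def reduced_x_def by blast+

lemma lookup_exponents:
  fixes i j k :: nat
  defines "m \<equiv> Poly_Mapping.single (1::3) i + Poly_Mapping.single 2 j + Poly_Mapping.single 3 k"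
  shows "Poly_Mapping.lookup m 1 = i" "Poly_Mapping.lookup m 2 = j" "Poly_Mapping.lookup m 3 = k"
  by (simp_all add: m_def lookup_add lookup_single when_def)

lemma reduced_mono3: "k < 3 \<Longrightarrow> reduced_z (mono3 c i j k)" "i < 24 \<Longrightarrow> reduced_x (mono3 c i j k)"
  by (auto simp: reduced_z_def reduced_x_def mono3_single lookup_exponents split: if_splits)

lemma reduced_zero: "reduced_z 0" "reduced_x 0"
  by (simp_all add: reduced_z_def reduced_x_def)

context coeff_subring
begin

lemma mono3_closed: "c \<in> K \<Longrightarrow> mono3 c i j k \<in> carrier R"
  unfolding mono3_single by (rule single_closed)

lemma fermat_closed: "fermat_form \<in> carrier R"
  unfolding fermat_form_def by (intro closed)

lemma Q_value_closed: "p \<in> carrier R \<Longrightarrow> q \<in> carrier R \<Longrightarrow> Q_value p q \<in> carrier R"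
  unfolding Q_value_def Q1_def Q2_def Q3_def by (intro closed)

lemma Q_quot_closed:
  "p \<in> carrier R \<Longrightarrow> q \<in> carrier R \<Longrightarrow> r \<in> carrier R \<Longrightarrow> Q_quot p q r \<in> carrier R"
  unfolding Q_quot_def Q2_def Q3_def by (intro closed)

definition has_remainder_z :: "poly3 set" where
  "has_remainder_z = {fermat_form * a + r |a r. a \<in> carrier R \<and> r \<in> carrier R \<and> reduced_z r}"

lemma has_remainder_z_add:
  assumes "f \<in> has_remainder_z" "g \<in> has_remainder_z"
  shows "f + g \<in> has_remainder_z"
proof -
  from assms obtain a r b s where "f = fermat_form * a + r" "a \<in> carrier R" "r \<in> carrier R" "reduced_z r"
    "g = fermat_form * b + s" "b \<in> carrier R" "s \<in> carrier R" "reduced_z s"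
    by (auto simp: has_remainder_z_def)
  then show ?thesis unfolding has_remainder_z_def
    by (intro CollectI exI[of _ "a + b"] exI[of _ "r + s"]) (simp add: closed reduced_add algebra_simps)
qed

lemma has_remainder_z_multiple: "a \<in> carrier R \<Longrightarrow> fermat_form * a \<in> has_remainder_z"
  unfolding has_remainder_z_def
  by (intro CollectI exI[of _ a] exI[of _ 0]) (simp add: closed reduced_zero)

lemma has_remainder_z_mono3: "c \<in> K \<Longrightarrow> mono3 c i j k \<in> has_remainder_z"
proof (induction k arbitrary: c i j rule: less_induct)
  case (less k)
  show ?case
  proof (cases "k < 3")
    case True
    then show ?thesis unfolding has_remainder_z_def
      by (intro CollectI exI[of _ 0] exI[of _ "mono3 c i j k"])
        (simp add: closed mono3_closed less.prems reduced_mono3)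
  next
    case False
    then obtain l where k: "k = l + 3" by (metis add.commute le_add_diff_inverse linorder_not_less)
    have "mono3 (- c) = (\<lambda>i j k. - mono3 c i j k)"
      by (simp add: fun_eq_iff mono3_def single_uminus)
    then have "mono3 c i j k = fermat_form * mono3 c i j l + (mono3 (- c) (i + 3) j l + mono3 (- c) i (j + 3) l)"
      by (simp add: k mono3_def fermat_form_def power_add algebra_simps)
    also have "\<dots> \<in> has_remainder_z"
      using less.prems by (intro has_remainder_z_add has_remainder_z_multiple mono3_closed less.IH)
        (simp_all add: k uminus_in)
    finally show ?thesis .
  qed
qed

lemma sum_in_additive:
  assumes "0 \<in> D" "\<And>f g. f \<in> D \<Longrightarrow> g \<in> D \<Longrightarrow> f + g \<in> D" "\<And>a. a \<in> A \<Longrightarrow> F a \<in> D"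
  shows "sum F A \<in> (D :: poly3 set)"
  using assms(3) by (induction A rule: infinite_finite_induct) (auto intro: assms(1,2))

lemma divide_by_fermat:
  assumes "f \<in> carrier R"
  obtains a r where "a \<in> carrier R" "r \<in> carrier R" "reduced_z r" "f = fermat_form * a + r"
proof -
  have "(\<Sum>m\<in>Poly_Mapping.keys f. Poly_Mapping.single m (Poly_Mapping.lookup f m)) \<in> has_remainder_z"
    using assms has_remainder_z_multiple[OF zero_closed] has_remainder_z_add
    by (intro sum_in_additive) (auto simp: single_mono3 carrier_iff intro: has_remainder_z_mono3)
  then have "f \<in> has_remainder_z" by (simp flip: poly_mapping_eq_sum_singles)
  then show ?thesis using that by (auto simp: has_remainder_z_def)
qed

definition has_remainder_x :: "poly3 set" where
  "has_remainder_x = {Qxy * a + r |a r. a \<in> carrier R \<and> r \<in> carrier R \<and> reduced_z r \<and> reduced_x r}"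

lemma has_remainder_x_add:
  assumes "f \<in> has_remainder_x" "g \<in> has_remainder_x"
  shows "f + g \<in> has_remainder_x"
proof -
  from assms obtain a r b s where "f = Qxy * a + r" "a \<in> carrier R" "r \<in> carrier R" "reduced_z r"
    "reduced_x r" "g = Qxy * b + s" "b \<in> carrier R" "s \<in> carrier R" "reduced_z s" "reduced_x s"
    unfolding has_remainder_x_def by blast
  then show ?thesis unfolding has_remainder_x_def
    by (intro CollectI exI[of _ "a + b"] exI[of _ "r + s"]) (simp add: closed reduced_add algebra_simps)
qed

lemma has_remainder_x_multiple: "a \<in> carrier R \<Longrightarrow> Qxy * a \<in> has_remainder_x"
  unfolding has_remainder_x_def
  by (intro CollectI exI[of _ a] exI[of _ 0]) (simp add: closed reduced_zero)

lemma mono3_numeral: "mono3 (c * numeral n) i j k = numeral n * mono3 c i j k"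
proof -
  have "Poly_Mapping.single 0 (c * numeral n) = Poly_Mapping.single 0 c * (numeral n :: poly3)"
    by (simp add: Poly_Mapping.mult_single flip: single_numeral)
  then show ?thesis by (simp add: mono3_def)
qed

lemma mono3_uminus: "mono3 (- c) i j k = - mono3 c i j k"
  by (simp add: mono3_def single_uminus)

lemma mono3_step_x:
  "mono3 c (i + 24) j k = Qxy * mono3 c i j k + (mono3 (- (c * 4)) (i + 21) (j + 3) k
    + mono3 (c * 17) (i + 18) (j + 6) k + mono3 (c * 65) (i + 15) (j + 9) k
    + mono3 (c * 89) (i + 12) (j + 12) k + mono3 (c * 65) (i + 9) (j + 15) k
    + mono3 (c * 17) (i + 6) (j + 18) k + mono3 (- (c * 4)) (i + 3) (j + 21) k
    + mono3 (- c) i (j + 24) k)"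
  unfolding mono3_uminus mono3_numeral unfolding Q_form_eq Q_value_expand mono3_def
  by (simp add: power_add algebra_simps)

lemma nat_in: "of_nat n \<in> K"
  by (induction n) (auto simp: zero_in one_in add_in)

lemma numeral_in: "numeral n \<in> K"
  using nat_in[of "numeral n"] by simp

lemma has_remainder_x_mono3: "c \<in> K \<Longrightarrow> k < 3 \<Longrightarrow> mono3 c i j k \<in> has_remainder_x"
proof (induction i arbitrary: c j rule: less_induct)
  case (less i)
  show ?case
  proof (cases "i < 24")
    case True
    then show ?thesis unfolding has_remainder_x_def
      by (intro CollectI exI[of _ 0] exI[of _ "mono3 c i j k"])
        (simp add: closed mono3_closed less.prems reduced_mono3)
  next
    case False
    then obtain l where i: "i = l + 24" by (metis add.commute le_add_diff_inverse linorder_not_less)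
    show ?thesis
      unfolding i mono3_step_x using less.prems
      by (intro has_remainder_x_add has_remainder_x_multiple mono3_closed less.IH)
        (simp_all add: i uminus_in mult_in numeral_in)
  qed
qed

lemma divide_by_Q:
  assumes "f \<in> carrier R" "reduced_z f"
  obtains a r where "a \<in> carrier R" "r \<in> carrier R" "reduced_z r" "reduced_x r" "f = Qxy * a + r"
proof -
  have "(\<Sum>m\<in>Poly_Mapping.keys f. Poly_Mapping.single m (Poly_Mapping.lookup f m)) \<in> has_remainder_x"
    using assms has_remainder_x_multiple[OF zero_closed] has_remainder_x_add
    by (intro sum_in_additive) (auto simp: single_mono3 carrier_iff reduced_z_def intro: has_remainder_x_mono3)
  then have "f \<in> has_remainder_x" by (simp flip: poly_mapping_eq_sum_singles)
  then show ?thesis using that unfolding has_remainder_x_def by blast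
qed

end


section \<open>Reduced polynomials vanishing at many points\<close>

text \<open>A polynomial in one variable with more zeros than its degree is zero, stated for a sum in which
  several summands may have the same exponent.\<close>

lemma collect_powers:
  fixes g :: "'m \<Rightarrow> complex" and e :: "'m \<Rightarrow> nat"
  assumes M: "finite M"
    and vanish: "\<And>x. x \<in> A \<Longrightarrow> (\<Sum>m\<in>M. g m * x ^ e m) = 0"
    and many: "\<And>m. finite A \<Longrightarrow> m \<in> M \<Longrightarrow> e m < card A"
  shows "(\<Sum>m\<in>{m \<in> M. e m = j}. g m) = 0"
proof -
  define p where "p = (\<Sum>m\<in>M. monom (g m) (e m))"
  have coeff: "coeff p j = (\<Sum>m\<in>{m \<in> M. e m = j}. g m)" for j
    by (simp add: p_def coeff_sum sum.If_cases M Int_def conj_commute)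
  have "poly p x = 0" if "x \<in> A" for x
    using vanish[OF that] by (simp add: p_def poly_sum poly_monom)
  then have sub: "A \<subseteq> {x. poly p x = 0}" by auto
  have "p = 0"
  proof (rule ccontr)
    assume p: "p \<noteq> 0"
    then have fin: "finite {x. poly p x = 0}" by (rule poly_roots_finite)
    then have A: "finite A" "card A \<le> degree p"
      using sub finite_subset card_mono[OF fin sub] card_poly_roots_bound[OF p] by auto
    have "coeff p (degree p) \<noteq> 0" using p by simp
    then obtain m where "m \<in> M" "e m = degree p"
      unfolding coeff by (metis (mono_tags, lifting) mem_Collect_eq sum.neutral)
    then show False using many[OF A(1)] A(2) by force
  qed
  then show ?thesis using coeff[of j] by simp
qed

lemma prod_UNIV_3: "(\<Prod>i\<in>(UNIV :: 3 set). F i) = F 1 * F 2 * (F 3 :: 'a::comm_monoid_mult)"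
  unfolding UNIV_3 by (simp add: mult.assoc)

lemma value3_vec3: "value3 f (vec3 x y z) = (\<Sum>m\<in>Poly_Mapping.keys f. Poly_Mapping.lookup f m *
    (x ^ Poly_Mapping.lookup m 1 * y ^ Poly_Mapping.lookup m 2 * z ^ Poly_Mapping.lookup m 3))"
  by (simp add: value3_def eval3_def prod_UNIV_3)

text \<open>The coefficients are isolated one variable at a time, first \<open>z\<close>, then \<open>x\<close>, then \<open>y\<close>. It is enough
  that \<open>f\<close> vanishes on a set with sufficiently many \<open>z\<close> above every \<open>(x, y)\<close>, sufficiently many \<open>x\<close>
  above every \<open>y\<close>, and infinitely many \<open>y\<close>.\<close>

lemma poly3_eq_zeroI:
  assumes "infinite S"
    and A: "\<And>y m. y \<in> S \<Longrightarrow> finite (A y) \<Longrightarrow> m \<in> Poly_Mapping.keys f \<Longrightarrow>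
      Poly_Mapping.lookup m 1 < card (A y)"
    and Z: "\<And>y x m. y \<in> S \<Longrightarrow> x \<in> A y \<Longrightarrow> finite (Z x y) \<Longrightarrow> m \<in> Poly_Mapping.keys f \<Longrightarrow>
      Poly_Mapping.lookup m 3 < card (Z x y)"
    and vanish: "\<And>x y z. y \<in> S \<Longrightarrow> x \<in> A y \<Longrightarrow> z \<in> Z x y \<Longrightarrow> value3 f (vec3 x y z) = 0"
  shows "f = 0"
proof (rule ccontr)
  assume "f \<noteq> 0"
  then obtain m where m: "m \<in> Poly_Mapping.keys f" by (auto simp flip: keys_eq_empty)
  let ?M = "Poly_Mapping.keys f" and ?c = "Poly_Mapping.lookup f"
  let ?e = "\<lambda>m i. Poly_Mapping.lookup m (i :: 3)"
  let ?M3 = "{n \<in> ?M. ?e n 3 = ?e m 3}"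
  let ?M1 = "{n \<in> ?M3. ?e n 1 = ?e m 1}"
  let ?M2 = "{n \<in> ?M1. ?e n 2 = ?e m 2}"
  have 3: "(\<Sum>n\<in>?M3. ?c n * (x ^ ?e n 1 * y ^ ?e n 2)) = 0" if "y \<in> S" "x \<in> A y" for x y
  proof (rule collect_powers[where A = "Z x y"])
    fix z assume "z \<in> Z x y"
    then show "(\<Sum>n\<in>?M. ?c n * (x ^ ?e n 1 * y ^ ?e n 2) * z ^ ?e n 3) = 0"
      using vanish[OF that] by (simp add: value3_vec3 mult.assoc)
  qed (use Z that in auto)
  have 1: "(\<Sum>n\<in>?M1. ?c n * y ^ ?e n 2) = 0" if "y \<in> S" for y
  proof (rule collect_powers[where A = "A y"])
    fix x assume "x \<in> A y"
    then show "(\<Sum>n\<in>?M3. ?c n * y ^ ?e n 2 * x ^ ?e n 1) = 0"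
      using 3[OF that] by (simp add: mult_ac)
  qed (use A that in auto)
  have "(\<Sum>n\<in>?M2. ?c n) = 0"
    by (rule collect_powers[where A = S]) (use 1 assms(1) in auto)
  moreover have "?M2 = {m}"
  proof -
    have "n = m" if "?e n 3 = ?e m 3" "?e n 1 = ?e m 1" "?e n 2 = ?e m 2" for n
    proof (rule poly_mapping_eqI)
      show "?e n i = ?e m i" for i using that exhaust_3[of i] by auto
    qed
    then show ?thesis using m by auto
  qed
  ultimately show False using m by (simp add: in_keys_iff)
qed

lemma value3_hom:
  "value3 (f + g) v = value3 f v + value3 g v" "value3 (f * g) v = value3 f v * value3 g v"
  by (simp_all add: value3_def coeff_id.eval3_hom)

lemma value3_Q_form: "value3 Qxy v = Q_value (v $ 1) (v $ 2)"
  by (simp add: value3_def coeff_id.eval3_hom Q_form_eq Q_value_def Q1_def Q2_def Q3_def)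

lemma cube_roots:
  assumes "x ^ 3 + y ^ 3 \<noteq> (0::complex)"
  shows "card {z. cubic (vec3 x y z) = 0} = 3"
proof -
  have roots: "{z. cubic (vec3 x y z) = 0} = {z. z ^ 3 = - (x ^ 3 + y ^ 3)}"
    by (auto simp: cubic_def eq_neg_iff_add_eq_0 algebra_simps)
  have "- (x ^ 3 + y ^ 3) \<noteq> 0" using assms by (metis neg_equal_0_iff_equal)
  then show ?thesis unfolding roots by (rule card_nth_roots) simp
qed

lemma Q_roots_scaled:
  assumes "y \<noteq> 0"
  shows "{x. Q_value x y = 0} = (\<lambda>t. t * y) ` Q_roots"
proof (intro equalityI subsetI)
  have scale: "Q_value (t * y) y = 0 \<longleftrightarrow> t \<in> Q_roots" for t
    using Q_value_scale[of y t 1] assms by (simp add: Q_roots_def mult.commute)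
  show "x \<in> (\<lambda>t. t * y) ` Q_roots" if "x \<in> {x. Q_value x y = 0}" for x
    using that scale[of "x / y"] assms by (intro image_eqI[of _ _ "x / y"]) simp_all
  show "x \<in> {x. Q_value x y = 0}" if "x \<in> (\<lambda>t. t * y) ` Q_roots" for x
    using that scale by auto
qed

lemma card_Q_roots_scaled:
  fixes y :: complex
  assumes "y \<noteq> 0"
  shows "finite {x. Q_value x y = 0}" "card {x. Q_value x y = 0} = 24"
  unfolding Q_roots_scaled[OF assms] using assms
  by (simp_all add: card_Q_roots card_image inj_on_def)

lemma Q_root_not_on_axis:
  assumes "y \<noteq> 0" "Q_value x y = 0"
  shows "x ^ 3 + y ^ 3 \<noteq> (0::complex)"
  using Q_value_imp_coordinates_nonzero(3)[of "vec3 x y 0"] assms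
  by (auto simp: cubic_def vec3_eq_iff)

text \<open>The cone over the type \<open>9\<close> points has, for every \<open>y \<noteq> 0\<close>, exactly 24 values of \<open>x\<close> and above each
  of them exactly 3 values of \<open>z\<close>; a remainder has too small degrees to vanish on it.\<close>

lemma reduced_vanishing:
  assumes "reduced_z f" "reduced_x f"
    and "\<And>v. v \<noteq> 0 \<Longrightarrow> cubic v = 0 \<Longrightarrow> Q_value (v $ 1) (v $ 2) = 0 \<Longrightarrow> value3 f v = 0"
  shows "f = 0"
proof (rule poly3_eq_zeroI[where S = "- {0}" and A = "\<lambda>y. {x. Q_value x y = 0}"
      and Z = "\<lambda>x y. {z. cubic (vec3 x y z) = 0}"])
  show "infinite (- {0 :: complex})"
    by (simp add: infinite_UNIV_char_0 finite_compl)
qed (use assms in \<open>auto simp: card_Q_roots_scaled cube_roots Q_root_not_on_axis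
    reduced_z_def reduced_x_def vec3_eq_iff\<close>)

text \<open>Here the zeros are the part of the cubic where \<open>Q(x, y) \<noteq> 0\<close>: for every \<open>y \<noteq> 0\<close> all but finitely
  many \<open>x\<close> have three values of \<open>z\<close> above them.\<close>

lemma reduced_z_vanishing:
  assumes "reduced_z f" and "\<And>v. cubic v = 0 \<Longrightarrow> Q_value (v $ 1) (v $ 2) \<noteq> 0 \<Longrightarrow> value3 f v = 0"
  shows "f = 0"
proof (rule poly3_eq_zeroI[where S = "- {0}" and
      A = "\<lambda>y. - ({x. Q_value x y = 0} \<union> {x. x ^ 3 = - (y ^ 3)})"
      and Z = "\<lambda>x y. {z. cubic (vec3 x y z) = 0}"])
  show "infinite (- {0 :: complex})"
    by (simp add: infinite_UNIV_char_0 finite_compl)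
  fix y :: complex and m assume y: "y \<in> - {0}"
  assume "finite (- ({x. Q_value x y = 0} \<union> {x. x ^ 3 = - (y ^ 3)}))"
  moreover have "finite {x. Q_value x y = 0}" "finite {x. x ^ 3 = - (y ^ 3)}"
    using y card_Q_roots_scaled finite_nth_roots by auto
  ultimately have "finite (UNIV :: complex set)"
    by (metis finite_Un finite_compl)
  then show "Poly_Mapping.lookup m 1 < card (- ({x. Q_value x y = 0} \<union> {x. x ^ 3 = - (y ^ 3)}))"
    by (simp add: infinite_UNIV_char_0)
next
  fix y x :: complex and m assume "x \<in> - ({x. Q_value x y = 0} \<union> {x. x ^ 3 = - (y ^ 3)})"
    "m \<in> Poly_Mapping.keys f"
  then show "Poly_Mapping.lookup m 3 < card {z. cubic (vec3 x y z) = 0}"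
    using cube_roots[of x y] assms(1) by (auto simp: reduced_z_def eq_neg_iff_add_eq_0)
qed (use assms(2) in auto)

section \<open>The homogeneous ideal\<close>

lemma homogeneous_add: "homogeneous d f \<Longrightarrow> homogeneous d g \<Longrightarrow> homogeneous d (f + g)"
  using Poly_Mapping.keys_add[of f g] unfolding homogeneous_def by blast

lemma homogeneous_uminus: "homogeneous d f \<Longrightarrow> homogeneous d (- f)"
  by (simp add: homogeneous_def)

lemma homogeneous_diff: "homogeneous d f \<Longrightarrow> homogeneous d g \<Longrightarrow> homogeneous d (f - g)"
  using homogeneous_add[OF _ homogeneous_uminus] by fastforce

lemma homogeneous_mult:
  assumes "homogeneous d f" "homogeneous e g"
  shows "homogeneous (d + e) (f * g)"
proof -
  have "monom_degree (m + n) = monom_degree m + monom_degree n" for m n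
    by (simp add: monom_degree_def lookup_add sum.distrib)
  then show ?thesis
    using keys_mult[of f g] assms unfolding homogeneous_def by fastforce
qed

lemma homogeneous_numeral: "homogeneous 0 (numeral n)"
proof -
  have "homogeneous 0 (Poly_Mapping.single 0 (numeral n))"
    by (simp add: homogeneous_def monom_degree_def del: single_numeral)
  then show ?thesis by simp
qed

lemma homogeneous_var_power: "homogeneous n (var3 i ^ n)"
  by (simp add: var3_power homogeneous_def monom_degree_def lookup_single when_def)

lemma homogeneous_fermat: "homogeneous 3 fermat_form"
  unfolding fermat_form_def by (intro homogeneous_add homogeneous_var_power)

lemma homogeneous_Q: "homogeneous 24 Qxy"
proof -
  have t: "homogeneous d (numeral n * var3 i ^ a * var3 j ^ b)" "homogeneous d (var3 i ^ a * var3 j ^ b)"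
    if "d = a + b" for d n i j a b
    using homogeneous_mult[OF homogeneous_mult[OF homogeneous_numeral[of n] homogeneous_var_power[of a i]]
        homogeneous_var_power[of b j]]
      homogeneous_mult[OF homogeneous_var_power[of a i] homogeneous_var_power[of b j]] that by simp_all
  have "homogeneous 9 (Q1 x_var y_var)" "homogeneous 6 (Q2 x_var y_var)" "homogeneous 9 (Q3 x_var y_var)"
    unfolding Q1_def Q2_def Q3_def
    by (intro homogeneous_add homogeneous_diff t homogeneous_var_power; simp)+
  then have "homogeneous (9 + 6 + 9) (Q1 x_var y_var * Q2 x_var y_var * Q3 x_var y_var)"
    by (intro homogeneous_mult)
  then show ?thesis by (simp add: Q_form_eq Q_value_def)
qed

text \<open>A point is the set of all its coordinate vectors, so vanishing on the points is vanishing on the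
  cone over them.\<close>

lemma vanishes_on_type9_set:
  "(\<forall>P\<in>type9_set. vanishes_at f P) \<longleftrightarrow>
    (\<forall>v. v \<noteq> 0 \<longrightarrow> cubic v = 0 \<longrightarrow> Q_value (v $ 1) (v $ 2) = 0 \<longrightarrow> value3 f v = 0)"
proof (intro iffI allI ballI impI)
  fix v assume "\<forall>P\<in>type9_set. vanishes_at f P"
    "v \<noteq> 0" "cubic v = 0" "Q_value (v $ 1) (v $ 2) = 0"
  then have "vanishes_at f (proj v)" unfolding type9_set_def by blast
  then show "value3 f v = 0" using self_in_proj unfolding vanishes_at_def by blast
next
  fix P
  assume f: "\<forall>v. v \<noteq> 0 \<longrightarrow> cubic v = 0 \<longrightarrow> Q_value (v $ 1) (v $ 2) = 0 \<longrightarrow> value3 f v = 0"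
  assume "P \<in> type9_set"
  then obtain v where v: "v \<noteq> 0" "cubic v = 0" "Q_value (v $ 1) (v $ 2) = 0" "P = proj v"
    unfolding type9_set_def by blast
  have "value3 f (c *s v) = 0" if "c \<noteq> 0" for c
    using f[rule_format, of "c *s v"] that v by (simp add: cubic_scale Q_value_scale)
  then show "vanishes_at f P" by (auto simp: vanishes_at_def v(4) proj_def)
qed

context coeff_subring
begin

lemma Qxy_closed: "Qxy \<in> carrier R"
  unfolding Q_form_eq by (intro Q_value_closed var_closed)

text \<open>A form that vanishes on the points leaves, after division by \<open>F\<close> and \<open>Q\<close>, a remainder that vanishes
  on the cone over them.\<close>

theorem vanishing_ideal_type9: "vanishing_ideal K type9_set = Idl\<^bsub>R\<^esub> {fermat_form, Qxy}"
proof
  interpret R: cring R by (rule cring_R)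
  let ?G = "{f \<in> carrier R. (\<exists>d. homogeneous d f) \<and> (\<forall>P\<in>type9_set. vanishes_at f P)}"
  have FQ: "{fermat_form, Qxy} \<subseteq> carrier R" using fermat_closed Qxy_closed by simp
  have "?G \<subseteq> Idl\<^bsub>R\<^esub> {fermat_form, Qxy}"
  proof
    fix f assume f: "f \<in> ?G"
    then have "f \<in> carrier R" by simp
    then obtain a r where ar: "a \<in> carrier R" "r \<in> carrier R" "reduced_z r" "f = fermat_form * a + r"
      by (rule divide_by_fermat)
    from ar(2,3) obtain b s where bs: "b \<in> carrier R" "s \<in> carrier R" "reduced_z s" "reduced_x s"
        "r = Qxy * b + s"
      by (rule divide_by_Q)
    have "s = 0"
    proof (rule reduced_vanishing[OF bs(3,4)])
      fix v assume v: "v \<noteq> 0" "cubic v = 0" "Q_value (v $ 1) (v $ 2) = 0"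
      then have "value3 f v = 0" using f vanishes_on_type9_set[of f] by blast
      then show "value3 s v = 0"
        using v by (simp add: ar(4) bs(5) value3_hom value3_fermat value3_Q_form)
    qed
    then have "f = fermat_form * a + Qxy * b" using ar(4) bs(5) by simp
    then show "f \<in> Idl\<^bsub>R\<^esub> {fermat_form, Qxy}"
      unfolding genideal_pair[OF fermat_closed Qxy_closed] using ar(1) bs(1) by blast
  qed
  then show "vanishing_ideal K type9_set \<subseteq> Idl\<^bsub>R\<^esub> {fermat_form, Qxy}"
    unfolding vanishing_ideal_def by (intro R.genideal_minimal R.genideal_ideal FQ)
  have "{fermat_form, Qxy} \<subseteq> ?G"
    using FQ homogeneous_fermat homogeneous_Q
    by (auto simp: vanishes_on_type9_set value3_fermat value3_Q_form)
  then have "{fermat_form, Qxy} \<subseteq> vanishing_ideal K type9_set"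
    unfolding vanishing_ideal_def using R.genideal_self[of ?G] by blast
  then show "Idl\<^bsub>R\<^esub> {fermat_form, Qxy} \<subseteq> vanishing_ideal K type9_set"
    unfolding vanishing_ideal_def by (intro R.genideal_minimal R.genideal_ideal) auto
qed

lemma genideal_Q_forms:
  "Idl\<^bsub>R\<^esub> {fermat_form, Q_form x_var z_var} = Idl\<^bsub>R\<^esub> {fermat_form, Qxy}"
  "Idl\<^bsub>R\<^esub> {fermat_form, Q_form y_var z_var} = Idl\<^bsub>R\<^esub> {fermat_form, Qxy}"
proof -
  have "Q_form x_var z_var - Qxy = fermat_form * Q_quot x_var y_var z_var"
    unfolding Q_form_eq Q_value_diff by (simp add: fermat_form_def)
  then show "Idl\<^bsub>R\<^esub> {fermat_form, Q_form x_var z_var} = Idl\<^bsub>R\<^esub> {fermat_form, Qxy}"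
    by (rule genideal_pair_cong[OF fermat_closed Qxy_closed
          Q_quot_closed[OF var_closed var_closed var_closed]])
  have "Q_form y_var z_var - Qxy = fermat_form * Q_quot y_var x_var z_var"
    using Q_value_diff[of y_var z_var x_var] Q_value_commute[of x_var y_var]
    by (simp add: Q_form_eq fermat_form_def ac_simps)
  then show "Idl\<^bsub>R\<^esub> {fermat_form, Q_form y_var z_var} = Idl\<^bsub>R\<^esub> {fermat_form, Qxy}"
    by (rule genideal_pair_cong[OF fermat_closed Qxy_closed
          Q_quot_closed[OF var_closed var_closed var_closed]])
qed

text \<open>If \<open>F\<close> divides \<open>Q h\<close> then the remainder of \<open>h\<close> modulo \<open>F\<close> vanishes on the cubic wherever \<open>Q\<close> does
  not, which forces it to be zero. That the ideal is proper is seen at the origin.\<close>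

lemma regular_sequence_fermat_Q: "regular_sequence R fermat_form Qxy"
  unfolding regular_sequence_def
proof (intro conjI ballI impI)
  have "value3 fermat_form (vec3 1 0 0) \<noteq> 0" by (simp add: value3_fermat cubic_def)
  then have "fermat_form \<noteq> 0" by (auto simp: value3_def)
  then show "h = \<zero>\<^bsub>R\<^esub>" if "fermat_form \<otimes>\<^bsub>R\<^esub> h = \<zero>\<^bsub>R\<^esub>" for h
    using that by simp
next
  fix h assume h: "h \<in> carrier R" "Qxy \<otimes>\<^bsub>R\<^esub> h \<in> Idl\<^bsub>R\<^esub> {fermat_form}"
  then obtain k where k: "Qxy * h = fermat_form * k"
    by (auto simp: genideal_single[OF fermat_closed])
  obtain a r where ar: "a \<in> carrier R" "r \<in> carrier R" "reduced_z r" "h = fermat_form * a + r"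
    using divide_by_fermat[OF h(1)] .
  have "r = 0"
  proof (rule reduced_z_vanishing[OF ar(3)])
    fix v assume v: "cubic v = 0" "Q_value (v $ 1) (v $ 2) \<noteq> 0"
    have "value3 (Qxy * h) v = 0" using v by (simp add: k value3_hom value3_fermat)
    then show "value3 r v = 0"
      using v by (simp add: ar(4) value3_hom value3_fermat value3_Q_form)
  qed
  then show "h \<in> Idl\<^bsub>R\<^esub> {fermat_form}"
    unfolding genideal_single[OF fermat_closed] using ar by auto
next
  have "value3 f 0 = 0" if "f \<in> Idl\<^bsub>R\<^esub> {fermat_form, Qxy}" for f
    using that unfolding genideal_pair[OF fermat_closed Qxy_closed]
    by (auto simp: value3_hom value3_fermat value3_Q_form cubic_def Q_value_def Q1_def)
  moreover have "value3 1 0 = 1" by (simp add: value3_def)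
  ultimately show "Idl\<^bsub>R\<^esub> {fermat_form, Qxy} \<noteq> carrier R" using one_closed by force
qed

theorem complete_intersection_type9: "complete_intersection K type9_set 3 24"
  unfolding complete_intersection_def
  using fermat_closed Qxy_closed homogeneous_fermat homogeneous_Q regular_sequence_fermat_Q
    vanishing_ideal_type9 by blast

end

lemma coeff_subring_UNIV: "coeff_subring UNIV"
  by standard auto

lemma coeff_subring_adjoin: "coeff_subring (adjoin A)"
proof -
  let ?C = "ring_of_type_algebra :: complex ring"
  interpret field ?C by (rule field_from_type_algebra)
  have C: "x \<otimes>\<^bsub>?C\<^esub> y = x * y" "x \<oplus>\<^bsub>?C\<^esub> y = x + y" "\<one>\<^bsub>?C\<^esub> = 1" "\<zero>\<^bsub>?C\<^esub> = 0" "carrier ?C = UNIV" for x y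
    by (simp_all add: ring_of_type_algebra_def)
  have minus: "\<ominus>\<^bsub>?C\<^esub> x = - x" for x
    by (rule minus_equality) (simp_all add: C)
  show ?thesis
    unfolding adjoin_def
    using generate_field.one[of ?C A] generate_field.eng_add[of _ ?C A] generate_field.eng_mult[of _ ?C A]
      generate_field.a_inv[of _ ?C A]
    by unfold_locales (simp_all add: C minus)
qed

theorem mainTheorem2:
  fixes \<alpha> \<beta> :: complex and e :: point
  assumes "\<alpha> = complex_of_real (root 3 3)"
    and "primitive_root_of_unity 9 \<beta>"
    and "flex e"
  shows "card (type9_points e) = 72 \<and>
    vanishing_ideal (adjoin {\<alpha>, \<beta>}) (type9_points e) =
      Idl\<^bsub>poly_ring3 (adjoin {\<alpha>, \<beta>})\<^esub> {fermat_form, Q_form x_var y_var} \<and>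
    vanishing_ideal (adjoin {\<alpha>, \<beta>}) (type9_points e) =
      Idl\<^bsub>poly_ring3 (adjoin {\<alpha>, \<beta>})\<^esub> {fermat_form, Q_form x_var z_var} \<and>
    vanishing_ideal (adjoin {\<alpha>, \<beta>}) (type9_points e) =
      Idl\<^bsub>poly_ring3 (adjoin {\<alpha>, \<beta>})\<^esub> {fermat_form, Q_form y_var z_var} \<and>
    complete_intersection (adjoin {\<alpha>, \<beta>}) (type9_points e) 3 24 \<and>
    complete_intersection UNIV (type9_points e) 3 24"
proof -
  have T: "type9_points e = type9_set"
    using type9_points_eq[OF assms(3)] by (simp add: type9_set_def)
  interpret K: coeff_subring "adjoin {\<alpha>, \<beta>}" by (rule coeff_subring_adjoin)
  interpret C: coeff_subring UNIV by (rule coeff_subring_UNIV)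
  show ?thesis
    unfolding T
    using card_type9_set K.vanishing_ideal_type9 K.genideal_Q_forms K.complete_intersection_type9
      C.complete_intersection_type9 by simp
qed

end
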